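(* Let $r$ be an odd natural number or $r=0$, and let $t$ be a positive integer with $t\mid r$ (every positive integer divides $0$). Then the group $\widehat H(r,t)$ (defined in the context) is a representation group of $H_3^t(\mathbb Z/r\mathbb Z)$.
   Context: $\mathbb Z/0\mathbb Z=\mathbb Z$. The group $H^t_{3}(\mathbb Z/r\mathbb Z)$ is the set $(\mathbb Z/r\mathbb Z)^3$ with multiplication $(a,b,c)(a',b',c')=(a+a'+t\,b'c,\;b+b',\;c+c')$. $[x,y]=xyx^{-1}y^{-1}$. The group $\widehat H(r,t)$ is given by the presentation $$\widehat H(r,t)=\langle x,y,z \mid [x,y]=z^t,\ [x,z]=z_1,\ [y,z]=z_2,\ x^r=y^r=z^{rt}=1\rangle,$$ with the convention that relations saying that two generators commute are omitted; that is, $z_1$ and $z_2$ are also generators, and $z_1$, $z_2$ commute with each other and with $x,y,z$ (so they are central). For $r=0$ the relations $x^r=y^r=z^{rt}=1$ are vacuous. All groups are considered as abstract (discrete) groups, and $\mathrm H^2(G,\mathbb C^\times)$ is taken with trivial action of $G$ on $\mathbb C^\times$. A group $G^*$ is a representation group of $G$ if there is a central extension $1\to A\to G^*\to G\to 1$ such that the corresponding transgression map $\mathrm{tra}:\mathrm{Hom}(A,\mathbb C^\times)\to \mathrm H^2(G,\mathbb C^\times)$ is an isomorphism. Here, for a set-theoretic section $\mu:G\to G^*$, $\mathrm{tra}(f)$ is the class of the 2-cocycle $(g,h)\mapsto f\big(\mu(g)\mu(h)\mu(gh)^{-1}\big)$. *)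

theory Defs
  imports "HOL-Algebra.Algebra" Complex_Main
begin

section \<open>Groups given by generators and relations\<close>

text \<open>A letter \<open>(s, True)\<close> is the generator \<open>s\<close>, a letter \<open>(s, False)\<close> is its formal inverse.
  All elements of the type \<open>'s\<close> are generators.\<close>

type_synonym 's gword = "('s \<times> bool) list"

definition gen_word :: "'s \<Rightarrow> 's gword" where
  "gen_word s = [(s, True)]"

definition inv_word :: "'s gword \<Rightarrow> 's gword" where
  "inv_word w = rev (map (\<lambda>(s, b). (s, \<not> b)) w)"

definition pow_word :: "'s gword \<Rightarrow> nat \<Rightarrow> 's gword" where
  "pow_word w n = concat (replicate n w)"

definition comm_word :: "'s gword \<Rightarrow> 's gword \<Rightarrow> 's gword" where
  "comm_word u v = u @ v @ inv_word u @ inv_word v"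

text \<open>A pair \<open>(u, v)\<close> in \<open>R\<close> stands for the relation \<open>u = v\<close>. The following is the congruence on the
  monoid of words generated by \<open>R\<close> and free cancellation, so its classes are the elements of the
  free group modulo the normal closure of all \<open>u v\<^sup>-\<^sup>1\<close>.\<close>

inductive word_cong :: "('s gword \<times> 's gword) set \<Rightarrow> 's gword \<Rightarrow> 's gword \<Rightarrow> bool"
  for R :: "('s gword \<times> 's gword) set"
  where
    refl: "word_cong R w w"
  | sym: "word_cong R u v \<Longrightarrow> word_cong R v u"
  | trans: "word_cong R u v \<Longrightarrow> word_cong R v w \<Longrightarrow> word_cong R u w"
  | cancel: "word_cong R (p @ [(s, b), (s, \<not> b)] @ q) (p @ q)"
  | relation: "(u, v) \<in> R \<Longrightarrow> word_cong R (p @ u @ q) (p @ v @ q)"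

definition presented_group :: "('s gword \<times> 's gword) set \<Rightarrow> 's gword set monoid" where
  "presented_group R = \<lparr>
     carrier = UNIV // {(u, v). word_cong R u v},
     monoid.mult = (\<lambda>U V. {w. \<exists>u\<in>U. \<exists>v\<in>V. word_cong R (u @ v) w}),
     one = {w. word_cong R [] w}\<rparr>"


section \<open>The two families of groups\<close>

text \<open>The construction makes sense over any ring \<open>R\<close>.\<close>

definition heisenberg_group :: "nat \<Rightarrow> ('a, 'm) ring_scheme \<Rightarrow> ('a \<times> 'a \<times> 'a) monoid" where
  "heisenberg_group t R = \<lparr>
     carrier = carrier R \<times> carrier R \<times> carrier R,
     monoid.mult = (\<lambda>(a, b, c) (a', b', c').
       (a \<oplus>\<^bsub>R\<^esub> a' \<oplus>\<^bsub>R\<^esub> add_pow R t (b' \<otimes>\<^bsub>R\<^esub> c), b \<oplus>\<^bsub>R\<^esub> b', c \<oplus>\<^bsub>R\<^esub> c')),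
     one = (\<zero>\<^bsub>R\<^esub>, \<zero>\<^bsub>R\<^esub>, \<zero>\<^bsub>R\<^esub>)\<rparr>"

text \<open>\<open>ZFact r\<close> is the quotient of the integers by the ideal generated by \<open>r\<close>; for \<open>r = 0\<close> it is
  the ring of integers itself, up to the isomorphism sending \<open>a\<close> to \<open>{a}\<close>.\<close>

definition H3 :: "nat \<Rightarrow> nat \<Rightarrow> (int set \<times> int set \<times> int set) monoid" where
  "H3 t r = heisenberg_group t (ZFact (int r))"

datatype hgen = GX | GY | GZ | GZ1 | GZ2

text \<open>For \<open>r = 0\<close> the three power relations read \<open>[] = []\<close> and are thus vacuous.\<close>

definition Hhat_relations :: "nat \<Rightarrow> nat \<Rightarrow> (hgen gword \<times> hgen gword) set" where
  "Hhat_relations r t =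
     (let x = gen_word GX; y = gen_word GY; z = gen_word GZ; z\<^sub>1 = gen_word GZ1; z\<^sub>2 = gen_word GZ2 in
      {(comm_word x y, pow_word z t), (comm_word x z, z\<^sub>1), (comm_word y z, z\<^sub>2),
       (pow_word x r, []), (pow_word y r, []), (pow_word z (r * t), []),
       (comm_word z\<^sub>1 x, []), (comm_word z\<^sub>1 y, []), (comm_word z\<^sub>1 z, []),
       (comm_word z\<^sub>2 x, []), (comm_word z\<^sub>2 y, []), (comm_word z\<^sub>2 z, []),
       (comm_word z\<^sub>1 z\<^sub>2, [])})"

definition Hhat :: "nat \<Rightarrow> nat \<Rightarrow> hgen gword set monoid" where
  "Hhat r t = presented_group (Hhat_relations r t)"


section \<open>Second cohomology with trivial action\<close>

text \<open>Cochains and homomorphisms are taken extensional (that is, \<open>undefined\<close> off the carrier), so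
  that two of them are equal as soon as they agree on the carrier.\<close>

definition two_cocycles ::
    "('g, 'x) monoid_scheme \<Rightarrow> ('m, 'y) monoid_scheme \<Rightarrow> ('g \<times> 'g \<Rightarrow> 'm) monoid" where
  "two_cocycles G M = \<lparr>
     carrier = {\<alpha> \<in> carrier G \<times> carrier G \<rightarrow>\<^sub>E carrier M.
       \<forall>g\<in>carrier G. \<forall>h\<in>carrier G. \<forall>k\<in>carrier G.
         \<alpha> (g, h) \<otimes>\<^bsub>M\<^esub> \<alpha> (g \<otimes>\<^bsub>G\<^esub> h, k) = \<alpha> (h, k) \<otimes>\<^bsub>M\<^esub> \<alpha> (g, h \<otimes>\<^bsub>G\<^esub> k)},
     monoid.mult = (\<lambda>\<alpha> \<beta>. \<lambda>p\<in>carrier G \<times> carrier G. \<alpha> p \<otimes>\<^bsub>M\<^esub> \<beta> p),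
     one = (\<lambda>p\<in>carrier G \<times> carrier G. \<one>\<^bsub>M\<^esub>)\<rparr>"

definition two_coboundaries ::
    "('g, 'x) monoid_scheme \<Rightarrow> ('m, 'y) monoid_scheme \<Rightarrow> ('g \<times> 'g \<Rightarrow> 'm) set" where
  "two_coboundaries G M =
     (\<lambda>c. \<lambda>(g, h)\<in>carrier G \<times> carrier G. c g \<otimes>\<^bsub>M\<^esub> c h \<otimes>\<^bsub>M\<^esub> inv\<^bsub>M\<^esub> (c (g \<otimes>\<^bsub>G\<^esub> h)))
       ` (carrier G \<rightarrow> carrier M)"

definition H2 ::
    "('g, 'x) monoid_scheme \<Rightarrow> ('m, 'y) monoid_scheme \<Rightarrow> ('g \<times> 'g \<Rightarrow> 'm) set monoid" where
  "H2 G M = two_cocycles G M Mod two_coboundaries G M"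

definition Hom_group ::
    "('a, 'x) monoid_scheme \<Rightarrow> ('m, 'y) monoid_scheme \<Rightarrow> ('a \<Rightarrow> 'm) monoid" where
  "Hom_group A M = \<lparr>
     carrier = hom A M \<inter> extensional (carrier A),
     monoid.mult = (\<lambda>f f'. \<lambda>a\<in>carrier A. f a \<otimes>\<^bsub>M\<^esub> f' a),
     one = (\<lambda>a\<in>carrier A. \<one>\<^bsub>M\<^esub>)\<rparr>"

definition complex_units :: "complex monoid" where
  "complex_units = \<lparr>carrier = UNIV - {0}, monoid.mult = (*), one = 1\<rparr>"


section \<open>Central extensions and representation groups\<close>

definition central_extension ::
    "('a, 'x) monoid_scheme \<Rightarrow> ('a \<Rightarrow> 'e) \<Rightarrow> ('e, 'y) monoid_scheme \<Rightarrow> ('e \<Rightarrow> 'g) \<Rightarrow>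
     ('g, 'z) monoid_scheme \<Rightarrow> bool" where
  "central_extension A i E p G \<longleftrightarrow>
     group A \<and> group E \<and> group G \<and>
     i \<in> mon A E \<and> p \<in> epi E G \<and> i ` carrier A = kernel E G p \<and>
     (\<forall>a\<in>carrier A. \<forall>e\<in>carrier E. i a \<otimes>\<^bsub>E\<^esub> e = e \<otimes>\<^bsub>E\<^esub> i a)"

definition set_section ::
    "('e, 'y) monoid_scheme \<Rightarrow> ('e \<Rightarrow> 'g) \<Rightarrow> ('g, 'z) monoid_scheme \<Rightarrow> ('g \<Rightarrow> 'e) \<Rightarrow> bool" where
  "set_section E p G \<mu> \<longleftrightarrow> \<mu> \<in> carrier G \<rightarrow> carrier E \<and> (\<forall>g\<in>carrier G. p (\<mu> g) = g)"

text \<open>The element \<open>\<mu>(g) \<mu>(h) \<mu>(gh)\<^sup>-\<^sup>1\<close> of \<open>E\<close> lies in the image of \<open>i\<close> and is pulled back to \<open>A\<close>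
  before \<open>f\<close> is applied.\<close>

definition transgression ::
    "('a, 'x) monoid_scheme \<Rightarrow> ('a \<Rightarrow> 'e) \<Rightarrow> ('e, 'y) monoid_scheme \<Rightarrow> ('g, 'z) monoid_scheme \<Rightarrow>
     ('m, 'w) monoid_scheme \<Rightarrow> ('g \<Rightarrow> 'e) \<Rightarrow> ('a \<Rightarrow> 'm) \<Rightarrow> ('g \<times> 'g \<Rightarrow> 'm) set" where
  "transgression A i E G M \<mu> f =
     two_coboundaries G M #>\<^bsub>two_cocycles G M\<^esub>
       (\<lambda>(g, h)\<in>carrier G \<times> carrier G.
          f (inv_into (carrier A) i (\<mu> g \<otimes>\<^bsub>E\<^esub> \<mu> h \<otimes>\<^bsub>E\<^esub> inv\<^bsub>E\<^esub> (\<mu> (g \<otimes>\<^bsub>G\<^esub> h)))))"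

text \<open>Since \<open>A\<close> embeds into \<open>E\<close>, nothing is lost by letting its elements have the same type as those
  of \<open>E\<close>. The transgression map does not depend on the section, and sections exist because \<open>p\<close> is
  surjective, so quantifying over all sections is the same as choosing one.\<close>

definition representation_group :: "'e monoid \<Rightarrow> 'g monoid \<Rightarrow> bool" where
  "representation_group E G \<longleftrightarrow>
     (\<exists>(A :: 'e monoid) i p. central_extension A i E p G \<and>
       (\<forall>\<mu>. set_section E p G \<mu> \<longrightarrow>
          transgression A i E G complex_units \<mu> \<in> iso (Hom_group A complex_units) (H2 G complex_units)))"

end

theory Submission
  imports Defs
begin

text \<open>Let \<open>A\<close> be the kernel of the projection of \<open>Hhat r t\<close> to \<open>H3 t r\<close>. Modulo the central subgroup
  generated by \<open>z\<^sub>1\<close> and \<open>z\<^sub>2\<close> every element has the form \<open>y\<^sup>j x\<^sup>i z\<^sup>k\<close>, so \<open>A\<close> is generated by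
  \<open>z\<^sub>1\<close>, \<open>z\<^sub>2\<close> and \<open>z\<^sup>r\<close>. It is central, because \<open>x\<^sup>r = y\<^sup>r = 1\<close> forces
  \<open>z\<^sub>1\<^sup>r = z\<^sub>2\<^sup>r = 1\<close>, and it lies in the commutator subgroup, because \<open>z\<^sup>t = [x, y]\<close> and \<open>t\<close>
  divides \<open>r\<close>.

  A character of \<open>A\<close> with trivial transgression extends to the whole group; the extension
  kills commutators, so the character is trivial. Conversely, a class in the second cohomology group
  is given by a central extension of \<open>H3 t r\<close> by the nonzero complex numbers. As these are divisible,
  the generators can be lifted so that \<open>x\<^sup>r = y\<^sup>r = 1\<close> and \<open>[x, y] = z\<^sup>t\<close>. Since \<open>r\<close> is odd
  or zero, \<open>z [^] (r * t) = 1\<close> is then automatic. Hence \<open>Hhat r t\<close> maps to the extension over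
  \<open>H3 t r\<close>, and the restriction of this map to \<open>A\<close> transgresses to the given class.\<close>

section \<open>Groups given by generators and relations\<close>

text \<open>The rules \<open>cancel\<close> and \<open>relation\<close> carry arbitrary contexts, so
  changing one factor is an induction that only enlarges the context. The two one-sided changes are
  then chained by transitivity.\<close>

lemma word_cong_append:
  assumes "word_cong R u u'" "word_cong R v v'"
  shows "word_cong R (u @ v) (u' @ v')"
proof -
  have left: "word_cong R (u @ v) (u' @ v)" for v
    using assms(1)
  proof (induction rule: word_cong.induct)
    case (cancel p s b q)
    show ?case using word_cong.cancel[of R p s b "q @ v"] by simp
  next
    case (relation a b p q)
    then show ?case using word_cong.relation[of a b R p "q @ v"] by simp
  qed (blast intro: word_cong.intros)+
  have right: "word_cong R (u @ v) (u @ v')" for u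
    using assms(2)
  proof (induction rule: word_cong.induct)
    case (cancel p s b q)
    show ?case using word_cong.cancel[of R "u @ p" s b q] by simp
  next
    case (relation a b p q)
    then show ?case using word_cong.relation[of a b R "u @ p" q] by simp
  qed (blast intro: word_cong.intros)+
  show ?thesis using left right word_cong.trans by blast
qed

lemma word_cong_inv_word_left: "word_cong R (inv_word w @ w) []"
proof (induction w)
  case Nil
  show ?case by (simp add: inv_word_def word_cong.refl)
next
  case (Cons a w)
  obtain s b where a: "a = (s, b)" by fastforce
  \<comment> \<open>The second letter is written with \<open>\<not> \<not> b\<close> so that the
    pair matches the rule \<open>cancel\<close>.\<close>
  have "word_cong R (inv_word w @ [(s, \<not> b), (s, \<not> \<not> b)] @ w) (inv_word w @ w)"
    by (rule word_cong.cancel)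
  then show ?case using Cons a word_cong.trans by (fastforce simp: inv_word_def)
qed

definition word_class :: "('s gword \<times> 's gword) set \<Rightarrow> 's gword \<Rightarrow> 's gword set" where
  "word_class R w = {v. word_cong R w v}"

lemma word_class_eq_iff: "word_class R u = word_class R v \<longleftrightarrow> word_cong R u v"
  unfolding word_class_def by (blast intro: word_cong.intros)

lemma carrier_presented_group: "carrier (presented_group R) = range (word_class R)"
  unfolding presented_group_def quotient_def word_class_def by auto

lemma word_class_closed [simp]: "word_class R w \<in> carrier (presented_group R)"
  by (simp add: carrier_presented_group)

lemma one_presented_group: "\<one>\<^bsub>presented_group R\<^esub> = word_class R []"
  by (simp add: presented_group_def word_class_def)

lemma mult_word_class:
  "word_class R u \<otimes>\<^bsub>presented_group R\<^esub> word_class R v = word_class R (u @ v)"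
proof -
  have "word_cong R (u @ v) w" if "word_cong R u u'" "word_cong R v v'" "word_cong R (u' @ v') w"
    for u' v' w
    using that word_cong_append word_cong.trans by blast
  moreover have "word_cong R u u" "word_cong R v v" by (rule word_cong.refl)+
  ultimately show ?thesis by (fastforce simp: presented_group_def word_class_def)
qed

lemma group_presented_group: "group (presented_group R)"
proof (rule groupI)
  show "x \<otimes>\<^bsub>presented_group R\<^esub> y \<in> carrier (presented_group R)"
    if "x \<in> carrier (presented_group R)" "y \<in> carrier (presented_group R)" for x y
    using that by (auto simp: carrier_presented_group mult_word_class)
  show "x \<otimes>\<^bsub>presented_group R\<^esub> y \<otimes>\<^bsub>presented_group R\<^esub> z
      = x \<otimes>\<^bsub>presented_group R\<^esub> (y \<otimes>\<^bsub>presented_group R\<^esub> z)"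
    if "x \<in> carrier (presented_group R)" "y \<in> carrier (presented_group R)"
      "z \<in> carrier (presented_group R)" for x y z
    using that by (auto simp: carrier_presented_group mult_word_class)
  show "\<one>\<^bsub>presented_group R\<^esub> \<in> carrier (presented_group R)"
    by (simp add: one_presented_group)
  show "\<one>\<^bsub>presented_group R\<^esub> \<otimes>\<^bsub>presented_group R\<^esub> x = x"
    if "x \<in> carrier (presented_group R)" for x
    using that by (auto simp: carrier_presented_group mult_word_class one_presented_group)
  show "\<exists>y\<in>carrier (presented_group R). y \<otimes>\<^bsub>presented_group R\<^esub> x = \<one>\<^bsub>presented_group R\<^esub>"
    if x: "x \<in> carrier (presented_group R)" for x
  proof -
    obtain w where "x = word_class R w" using x by (auto simp: carrier_presented_group)
    then have "word_class R (inv_word w) \<otimes>\<^bsub>presented_group R\<^esub> x = \<one>\<^bsub>presented_group R\<^esub>"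
      by (simp add: mult_word_class one_presented_group word_class_eq_iff word_cong_inv_word_left)
    then show ?thesis by (intro bexI) auto
  qed
qed

section \<open>Evaluation of words and the universal property\<close>

definition eval_word :: "('a, 'm) monoid_scheme \<Rightarrow> ('s \<Rightarrow> 'a) \<Rightarrow> 's gword \<Rightarrow> 'a" where
  "eval_word G \<phi> w = foldr (\<lambda>(s, b) a. (if b then \<phi> s else inv\<^bsub>G\<^esub> \<phi> s) \<otimes>\<^bsub>G\<^esub> a) w \<one>\<^bsub>G\<^esub>"

lemma eval_word_Nil [simp]: "eval_word G \<phi> [] = \<one>\<^bsub>G\<^esub>"
  by (simp add: eval_word_def)

lemma eval_word_Cons:
  "eval_word G \<phi> ((s, b) # w) = (if b then \<phi> s else inv\<^bsub>G\<^esub> \<phi> s) \<otimes>\<^bsub>G\<^esub> eval_word G \<phi> w"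
  by (simp add: eval_word_def)

context group
begin

context
  fixes \<phi> :: "'s \<Rightarrow> 'a"
  assumes \<phi> [simp]: "\<And>s. \<phi> s \<in> carrier G"
begin

lemma eval_word_closed [simp]: "eval_word G \<phi> w \<in> carrier G"
  by (induction w) (auto simp: eval_word_Cons)

lemma eval_word_append: "eval_word G \<phi> (u @ v) = eval_word G \<phi> u \<otimes> eval_word G \<phi> v"
  by (induction u) (auto simp: eval_word_Cons m_assoc)

lemma eval_gen_word: "eval_word G \<phi> (gen_word s) = \<phi> s"
  by (simp add: gen_word_def eval_word_Cons)

lemma eval_inv_word: "eval_word G \<phi> (inv_word w) = inv eval_word G \<phi> w"
proof (induction w)
  case (Cons a w)
  obtain s b where "a = (s, b)" by fastforce
  moreover have "inv_word ((s, b) # w) = inv_word w @ [(s, \<not> b)]" by (simp add: inv_word_def)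
  ultimately show ?case using Cons
    by (simp add: eval_word_append eval_word_Cons inv_mult_group)
qed (simp add: inv_word_def)

lemma eval_pow_word: "eval_word G \<phi> (pow_word w n) = eval_word G \<phi> w [^] n"
proof (induction n)
  case (Suc n)
  have "pow_word w (Suc n) = w @ pow_word w n" by (simp add: pow_word_def)
  then show ?case using Suc nat_pow_Suc2[of "eval_word G \<phi> w" n]
    by (simp add: eval_word_append)
qed (simp add: pow_word_def)

lemma eval_comm_word:
  "eval_word G \<phi> (comm_word u v) =
     eval_word G \<phi> u \<otimes> eval_word G \<phi> v \<otimes> inv eval_word G \<phi> u \<otimes> inv eval_word G \<phi> v"
  by (simp add: comm_word_def eval_word_append eval_inv_word m_assoc)

lemma eval_word_cong:
  assumes "word_cong R u v"
    and "\<And>u v. (u, v) \<in> R \<Longrightarrow> eval_word G \<phi> u = eval_word G \<phi> v"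
  shows "eval_word G \<phi> u = eval_word G \<phi> v"
  using assms(1)
proof (induction rule: word_cong.induct)
  case (cancel p s b q)
  have "eval_word G \<phi> [(s, b), (s, \<not> b)] = \<one>" by (simp add: eval_word_Cons)
  then show ?case unfolding eval_word_append by simp
next
  case (relation u v p q)
  then show ?case using assms(2) by (simp add: eval_word_append)
qed simp_all

text \<open>Von Dyck's theorem. A representative of each class is picked by \<open>SOME\<close>, and
  \<open>eval_word_cong\<close> makes the value independent of that choice.\<close>

lemma presented_group_hom:
  assumes "\<And>u v. (u, v) \<in> R \<Longrightarrow> eval_word G \<phi> u = eval_word G \<phi> v"
  obtains h where "h \<in> hom (presented_group R) G"
    and "\<And>w. h (word_class R w) = eval_word G \<phi> w"
proof
  define h where "h = (\<lambda>U. eval_word G \<phi> (SOME w. w \<in> U))"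
  show h: "h (word_class R w) = eval_word G \<phi> w" for w
  proof -
    have "(SOME v. v \<in> word_class R w) \<in> word_class R w"
      by (rule someI[of _ w]) (simp add: word_class_def word_cong.refl)
    then show ?thesis
      unfolding h_def using eval_word_cong[OF _ assms] by (simp add: word_class_def)
  qed
  show "h \<in> hom (presented_group R) G"
    by (rule homI) (auto simp: carrier_presented_group mult_word_class h eval_word_append)
qed

end

end

text \<open>Through this, facts about evaluation in an arbitrary group apply to the presented group
  itself, where they turn the relations into equations between the generators.\<close>

lemma eval_word_presented_group:
  "eval_word (presented_group R) (\<lambda>s. word_class R (gen_word s)) w = word_class R w"
proof (induction w)
  case (Cons a w)
  interpret group "presented_group R" by (rule group_presented_group)
  obtain s b where a: "a = (s, b)" by fastforce
  have "inv\<^bsub>presented_group R\<^esub> word_class R [(s, True)] = word_class R [(s, False)]"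
    using word_cong.cancel[of R "[]" s False "[]"]
    by (intro inv_equality) (auto simp: mult_word_class one_presented_group word_class_eq_iff)
  with Cons a show ?case by (auto simp: eval_word_Cons gen_word_def mult_word_class)
qed (simp add: one_presented_group)

lemma eval_relation_presented_group:
  assumes "(u, v) \<in> R"
  defines "\<phi> \<equiv> \<lambda>s. word_class R (gen_word s)"
  shows "eval_word (presented_group R) \<phi> u = eval_word (presented_group R) \<phi> v"
  unfolding \<phi>_def eval_word_presented_group word_class_eq_iff
  using word_cong.relation[OF assms(1), of "[]" "[]"] by simp


section \<open>Commutators and powers\<close>

text \<open>Serves as an induction principle: a property that cuts out a subgroup need only be
  checked on the generators.\<close>

lemma subgroup_presented_group_eqI:
  assumes "subgroup S (presented_group R)" and "\<And>s. word_class R (gen_word s) \<in> S"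
  shows "S = carrier (presented_group R)"
proof -
  interpret S: subgroup S "presented_group R" by fact
  interpret group "presented_group R" by (rule group_presented_group)
  have "eval_word (presented_group R) (\<lambda>s. word_class R (gen_word s)) w \<in> S" for w
    by (induction w) (auto simp: eval_word_Cons assms(2))
  then have "carrier (presented_group R) \<subseteq> S"
    by (auto simp: eval_word_presented_group carrier_presented_group)
  then show ?thesis using S.subset by blast
qed

lemma (in group) inv_mult_cancel:
  assumes "g \<in> carrier G" "h \<in> carrier G"
  shows "inv g \<otimes> (g \<otimes> h) = h" "g \<otimes> (inv g \<otimes> h) = h"
  using assms by (simp_all add: m_assoc[symmetric])

text \<open>Carries commutation with \<open>a\<close> from generators to generated subgroups and to
  integer powers.\<close>

lemma (in group) subgroup_centralizer:
  assumes "a \<in> carrier G"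
  shows "subgroup {g \<in> carrier G. a \<otimes> g = g \<otimes> a} G"
proof (rule subgroupI)
  show "inv g \<in> {g \<in> carrier G. a \<otimes> g = g \<otimes> a}" if "g \<in> {g \<in> carrier G. a \<otimes> g = g \<otimes> a}" for g
  proof -
    have g: "g \<in> carrier G" "a \<otimes> g = g \<otimes> a" using that by auto
    then have "inv g \<otimes> (a \<otimes> g) \<otimes> inv g = inv g \<otimes> (g \<otimes> a) \<otimes> inv g" by simp
    then have "inv g \<otimes> a = a \<otimes> inv g" using g(1) assms by (simp add: m_assoc inv_mult_cancel)
    then show ?thesis using g(1) by simp
  qed
  show "g \<otimes> h \<in> {g \<in> carrier G. a \<otimes> g = g \<otimes> a}"
    if "g \<in> {g \<in> carrier G. a \<otimes> g = g \<otimes> a}" "h \<in> {g \<in> carrier G. a \<otimes> g = g \<otimes> a}" for g h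
    using that assms by (auto simp: m_assoc[symmetric]) (simp add: m_assoc)
qed (use assms in auto)

lemma (in group) commutes_generate:
  assumes "a \<in> carrier G" "A \<subseteq> carrier G" "\<And>b. b \<in> A \<Longrightarrow> a \<otimes> b = b \<otimes> a" "g \<in> generate G A"
  shows "a \<otimes> g = g \<otimes> a"
proof -
  have "generate G A \<subseteq> {g \<in> carrier G. a \<otimes> g = g \<otimes> a}"
    using assms by (intro generate_subgroup_incl subgroup_centralizer) auto
  then show ?thesis using assms(4) by blast
qed

lemma (in group) commutes_int_pow:
  assumes "a \<in> carrier G" "b \<in> carrier G" "a \<otimes> b = b \<otimes> a"
  shows "a \<otimes> b [^] (k::int) = b [^] k \<otimes> a"
proof -
  have "b [^] k \<in> {g \<in> carrier G. a \<otimes> g = g \<otimes> a}"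
    by (rule subgroup_int_pow_closed[OF subgroup_centralizer[OF assms(1)]]) (use assms in simp)
  then show ?thesis by blast
qed

lemma (in group) commutes_nat_pow:
  assumes "a \<in> carrier G" "b \<in> carrier G" "a \<otimes> b = b \<otimes> a"
  shows "a \<otimes> b [^] (k::nat) = b [^] k \<otimes> a"
  using commutes_int_pow[OF assms, of "int k"] by (simp add: int_pow_int)

text \<open>Conjugation by \<open>x\<close> is an endomorphism taking \<open>y\<close> to
  \<open>c \<otimes> y\<close>. As \<open>c\<close> commutes with \<open>y\<close>, the power of
  this product splits.\<close>

lemma (in group) mult_int_pow_eq:
  assumes [simp]: "x \<in> carrier G" "y \<in> carrier G" "c \<in> carrier G"
    and xy: "x \<otimes> y = c \<otimes> y \<otimes> x" and yc: "y \<otimes> c = c \<otimes> y"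
  shows "x \<otimes> y [^] (j::int) = c [^] j \<otimes> y [^] j \<otimes> x"
proof -
  have "x \<otimes> y \<otimes> inv x = c \<otimes> y" by (simp add: xy m_assoc)
  have conj: "x \<otimes> u [^] j \<otimes> inv x = (x \<otimes> u \<otimes> inv x) [^] j" if "u \<in> carrier G" for u
  proof -
    have "(\<lambda>g. x \<otimes> g \<otimes> inv x) \<in> hom G G"
      by (rule homI) (simp_all add: m_assoc inv_mult_cancel)
    then show ?thesis using hom_int_pow[of _ G G u j] that is_group by simp
  qed
  have "x \<otimes> y [^] j \<otimes> inv x = c [^] j \<otimes> y [^] j"
    using yc by (simp add: conj \<open>x \<otimes> y \<otimes> inv x = c \<otimes> y\<close> int_pow_mult_distrib)
  then show ?thesis by (simp add: inv_solve_right')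
qed

text \<open>Bilinearity of the commutator. The preceding lemma is applied twice: first to
  \<open>y [^] j\<close>, then with the roles exchanged, where the commutator of
  \<open>y [^] j\<close> and \<open>x\<close> is the inverse of \<open>d\<close>.\<close>

lemma (in group) int_pow_mult_int_pow_eq:
  assumes [simp]: "x \<in> carrier G" "y \<in> carrier G" "c \<in> carrier G"
    and xy: "x \<otimes> y = c \<otimes> y \<otimes> x" and xc: "x \<otimes> c = c \<otimes> x" and yc: "y \<otimes> c = c \<otimes> y"
  shows "x [^] (i::int) \<otimes> y [^] (j::int) = c [^] (i * j) \<otimes> y [^] j \<otimes> x [^] i"
proof -
  define d where "d = c [^] j"
  have d [simp]: "d \<in> carrier G" by (simp add: d_def)
  have dx: "x \<otimes> d = d \<otimes> x" unfolding d_def using xc by (intro commutes_int_pow) auto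
  have "inv d \<otimes> (x \<otimes> y [^] j) = y [^] j \<otimes> x"
    unfolding mult_int_pow_eq[OF assms(1-4) yc, of j] d_def[symmetric]
    by (simp add: m_assoc inv_mult_cancel)
  then have *: "y [^] j \<otimes> x = inv d \<otimes> x \<otimes> y [^] j" by (simp add: m_assoc)
  have "inv d \<otimes> x = x \<otimes> inv d"
    using commutes_int_pow[OF _ _ dx, of "-1"] by (simp add: int_pow_neg)
  then have "y [^] j \<otimes> x [^] i = inv d [^] i \<otimes> x [^] i \<otimes> y [^] j"
    by (intro mult_int_pow_eq[OF _ _ _ *]) simp_all
  moreover have "inv d [^] i = inv (c [^] (i * j))"
    by (simp add: d_def int_pow_inv int_pow_pow mult.commute)
  ultimately show ?thesis by (simp add: m_assoc inv_solve_left)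
qed

text \<open>By bilinearity the commutator of \<open>x [^] r\<close> with \<open>y\<close> is
  \<open>c [^] r\<close>, and \<open>x [^] r\<close> is trivial. Applied with \<open>z\<close> in
  place of \<open>y\<close>, this kills the \<open>r\<close>-th powers of \<open>gz1\<close> and
  \<open>gz2\<close>.\<close>

lemma (in group) conj_int_pow_trivial:
  assumes [simp]: "x \<in> carrier G" "y \<in> carrier G" "c \<in> carrier G"
    and xy: "x \<otimes> y = c \<otimes> y \<otimes> x" and xc: "x \<otimes> c = c \<otimes> x" and yc: "y \<otimes> c = c \<otimes> y"
    and xr: "x [^] (r::nat) = \<one>"
  shows "c [^] r = \<one>"
proof -
  have "x [^] int r \<otimes> y [^] (1::int) = c [^] int r \<otimes> y [^] (1::int) \<otimes> x [^] int r"
    using int_pow_mult_int_pow_eq[OF assms(1-6), of "int r" 1] by simp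
  then show ?thesis by (simp add: int_pow_int xr)
qed

text \<open>Here \<open>x [^] n \<otimes> y\<close> picks up the exponent \<open>n choose 2\<close>, which is divisible by \<open>n\<close> for odd \<open>n\<close>.\<close>

lemma (in group) pow_commutator_eq_one:
  assumes [simp]: "x \<in> carrier G" "y \<in> carrier G" "z \<in> carrier G" "c \<in> carrier G"
    and xy: "x \<otimes> y = z [^] t \<otimes> y \<otimes> x" and xz: "x \<otimes> z = c \<otimes> z \<otimes> x"
    and xc: "x \<otimes> c = c \<otimes> x" and zc: "z \<otimes> c = c \<otimes> z"
    and xr: "x [^] (r::nat) = \<one>" and r: "odd r \<or> r = 0"
  shows "z [^] (r * t) = \<one>"
proof (cases "r = 0")
  case False
  have xzm: "x \<otimes> z [^] m = c [^] m \<otimes> z [^] m \<otimes> x" for m :: nat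
    using mult_int_pow_eq[OF _ _ _ xz zc, of "int m"] by (simp add: int_pow_int)
  have xcm: "x \<otimes> c [^] m = c [^] m \<otimes> x" for m :: nat
    by (rule commutes_nat_pow[OF _ _ xc]) simp_all
  have "x [^] n \<otimes> y = c [^] (t * (n choose 2)) \<otimes> z [^] (t * n) \<otimes> y \<otimes> x [^] n" for n
  proof (induction n)
    case (Suc n)
    define e where "e = t * (n choose 2)"
    define m where "m = t * n"
    \<comment> \<open>Pascal's rule times \<open>t\<close>: moving one more \<open>x\<close> past
      \<open>z [^] m\<close> contributes exactly \<open>c [^] m\<close>.\<close>
    have e: "t * (Suc n choose 2) = e + m"
      by (simp add: e_def m_def numeral_2_eq_2 algebra_simps)
    have m: "t * Suc n = m + t" by (simp add: m_def)
    have "x [^] Suc n \<otimes> y = x \<otimes> (x [^] n \<otimes> y)" unfolding nat_pow_Suc2[OF assms(1)] by (simp add: m_assoc)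
    also have "\<dots> = (x \<otimes> c [^] e) \<otimes> z [^] m \<otimes> y \<otimes> x [^] n"
      unfolding Suc by (simp add: m_assoc e_def m_def)
    also have "\<dots> = c [^] e \<otimes> (x \<otimes> z [^] m) \<otimes> y \<otimes> x [^] n"
      unfolding xcm by (simp add: m_assoc)
    also have "\<dots> = c [^] e \<otimes> c [^] m \<otimes> z [^] m \<otimes> (x \<otimes> y) \<otimes> x [^] n"
      unfolding xzm by (simp add: m_assoc)
    also have "\<dots> = (c [^] e \<otimes> c [^] m) \<otimes> (z [^] m \<otimes> z [^] t) \<otimes> y \<otimes> (x \<otimes> x [^] n)"
      unfolding xy by (simp add: m_assoc)
    also have "\<dots> = c [^] (t * (Suc n choose 2)) \<otimes> z [^] (t * Suc n) \<otimes> y \<otimes> x [^] Suc n"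
      unfolding e m nat_pow_Suc2[OF assms(1)] by (simp add: nat_pow_mult)
    finally show ?case .
  qed (simp add: numeral_2_eq_2)
  from this[of r] have "\<one> = c [^] (t * (r choose 2)) \<otimes> z [^] (t * r)" by (simp add: xr)
  moreover obtain b where "r = 2 * b + 1" using r False by (auto elim: oddE)
  then have "r choose 2 = r * b"
    using div_mult_self1_is_m[of 2 "r * b"] by (simp add: choose_two mult.left_commute)
  then have "r dvd r choose 2" by simp
  then obtain k where "t * (r choose 2) = r * k" by (metis dvd_mult dvdE)
  then have "c [^] (t * (r choose 2)) = \<one>"
    using conj_int_pow_trivial[OF _ _ _ xz xc zc xr] nat_pow_pow[of c r k] by simp
  ultimately show ?thesis by (simp add: mult.commute)
qed simp


section \<open>Second cohomology\<close>

locale trivial_module = G: group G + M: comm_group M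
  for G :: "('g, 'x) monoid_scheme" (structure) and M :: "('m, 'y) monoid_scheme"
begin

definition coboundary :: "('g \<Rightarrow> 'm) \<Rightarrow> 'g \<times> 'g \<Rightarrow> 'm" where
  "coboundary c = (\<lambda>(g, h)\<in>carrier G \<times> carrier G. c g \<otimes>\<^bsub>M\<^esub> c h \<otimes>\<^bsub>M\<^esub> inv\<^bsub>M\<^esub> (c (g \<otimes> h)))"

lemma coboundary_apply [simp]:
  "g \<in> carrier G \<Longrightarrow> h \<in> carrier G \<Longrightarrow>
    coboundary c (g, h) = c g \<otimes>\<^bsub>M\<^esub> c h \<otimes>\<^bsub>M\<^esub> inv\<^bsub>M\<^esub> (c (g \<otimes> h))"
  by (simp add: coboundary_def)

lemma two_coboundaries_eq: "two_coboundaries G M = coboundary ` (carrier G \<rightarrow> carrier M)"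
  by (simp add: two_coboundaries_def coboundary_def[abs_def])

lemma two_cocyclesI:
  assumes "\<alpha> \<in> extensional (carrier G \<times> carrier G)"
    and "\<And>g h. g \<in> carrier G \<Longrightarrow> h \<in> carrier G \<Longrightarrow> \<alpha> (g, h) \<in> carrier M"
    and "\<And>g h k. g \<in> carrier G \<Longrightarrow> h \<in> carrier G \<Longrightarrow> k \<in> carrier G \<Longrightarrow>
      \<alpha> (g, h) \<otimes>\<^bsub>M\<^esub> \<alpha> (g \<otimes> h, k) = \<alpha> (h, k) \<otimes>\<^bsub>M\<^esub> \<alpha> (g, h \<otimes> k)"
  shows "\<alpha> \<in> carrier (two_cocycles G M)"
  using assms by (auto simp: two_cocycles_def PiE_def)

lemma two_cocycle_closed [simp]:
  "\<alpha> \<in> carrier (two_cocycles G M) \<Longrightarrow> g \<in> carrier G \<Longrightarrow> h \<in> carrier G \<Longrightarrow> \<alpha> (g, h) \<in> carrier M"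
  by (auto simp: two_cocycles_def)

lemma two_cocycle_eq:
  "\<alpha> \<in> carrier (two_cocycles G M) \<Longrightarrow> g \<in> carrier G \<Longrightarrow> h \<in> carrier G \<Longrightarrow> k \<in> carrier G \<Longrightarrow>
    \<alpha> (g, h) \<otimes>\<^bsub>M\<^esub> \<alpha> (g \<otimes> h, k) = \<alpha> (h, k) \<otimes>\<^bsub>M\<^esub> \<alpha> (g, h \<otimes> k)"
  by (auto simp: two_cocycles_def)

lemma two_cocycle_eqI:
  assumes "\<alpha> \<in> extensional (carrier G \<times> carrier G)" "\<beta> \<in> extensional (carrier G \<times> carrier G)"
    and "\<And>g h. g \<in> carrier G \<Longrightarrow> h \<in> carrier G \<Longrightarrow> \<alpha> (g, h) = \<beta> (g, h)"
  shows "\<alpha> = \<beta>"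
  by (rule extensionalityI[OF assms(1,2)]) (auto simp: assms(3))

lemma two_cocycle_extensional:
  "\<alpha> \<in> carrier (two_cocycles G M) \<Longrightarrow> \<alpha> \<in> extensional (carrier G \<times> carrier G)"
  by (simp add: two_cocycles_def PiE_def)

lemma mult_two_cocycles_extensional:
  "\<alpha> \<otimes>\<^bsub>two_cocycles G M\<^esub> \<beta> \<in> extensional (carrier G \<times> carrier G)"
  by (simp add: two_cocycles_def)

lemma mult_two_cocycles_apply [simp]:
  "g \<in> carrier G \<Longrightarrow> h \<in> carrier G \<Longrightarrow>
    (\<alpha> \<otimes>\<^bsub>two_cocycles G M\<^esub> \<beta>) (g, h) = \<alpha> (g, h) \<otimes>\<^bsub>M\<^esub> \<beta> (g, h)"
  by (simp add: two_cocycles_def)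

lemma one_two_cocycles_apply [simp]:
  "g \<in> carrier G \<Longrightarrow> h \<in> carrier G \<Longrightarrow> \<one>\<^bsub>two_cocycles G M\<^esub> (g, h) = \<one>\<^bsub>M\<^esub>"
  by (simp add: two_cocycles_def)

lemma one_two_cocycles_extensional:
  "\<one>\<^bsub>two_cocycles G M\<^esub> \<in> extensional (carrier G \<times> carrier G)"
  by (simp add: two_cocycles_def)

lemmas extensional_simps =
  two_cocycle_extensional mult_two_cocycles_extensional one_two_cocycles_extensional

lemma comm_group_two_cocycles: "comm_group (two_cocycles G M)"
proof (rule comm_groupI)
  show "\<alpha> \<otimes>\<^bsub>two_cocycles G M\<^esub> \<beta> \<in> carrier (two_cocycles G M)"
    if "\<alpha> \<in> carrier (two_cocycles G M)" "\<beta> \<in> carrier (two_cocycles G M)" for \<alpha> \<beta>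
  proof (rule two_cocyclesI)
    fix g h k assume [simp]: "g \<in> carrier G" "h \<in> carrier G" "k \<in> carrier G"
    have "(\<alpha> (g, h) \<otimes>\<^bsub>M\<^esub> \<alpha> (g \<otimes> h, k)) \<otimes>\<^bsub>M\<^esub> (\<beta> (g, h) \<otimes>\<^bsub>M\<^esub> \<beta> (g \<otimes> h, k)) =
      (\<alpha> (h, k) \<otimes>\<^bsub>M\<^esub> \<alpha> (g, h \<otimes> k)) \<otimes>\<^bsub>M\<^esub> (\<beta> (h, k) \<otimes>\<^bsub>M\<^esub> \<beta> (g, h \<otimes> k))"
      using that by (simp add: two_cocycle_eq)
    then show "(\<alpha> \<otimes>\<^bsub>two_cocycles G M\<^esub> \<beta>) (g, h) \<otimes>\<^bsub>M\<^esub> (\<alpha> \<otimes>\<^bsub>two_cocycles G M\<^esub> \<beta>) (g \<otimes> h, k) =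
      (\<alpha> \<otimes>\<^bsub>two_cocycles G M\<^esub> \<beta>) (h, k) \<otimes>\<^bsub>M\<^esub> (\<alpha> \<otimes>\<^bsub>two_cocycles G M\<^esub> \<beta>) (g, h \<otimes> k)"
      using that by (simp add: M.m_ac)
  qed (use that in \<open>auto simp: extensional_simps\<close>)
  show "\<exists>\<beta>\<in>carrier (two_cocycles G M). \<beta> \<otimes>\<^bsub>two_cocycles G M\<^esub> \<alpha> = \<one>\<^bsub>two_cocycles G M\<^esub>"
    if \<alpha>: "\<alpha> \<in> carrier (two_cocycles G M)" for \<alpha>
  proof
    let ?\<beta> = "\<lambda>p\<in>carrier G \<times> carrier G. inv\<^bsub>M\<^esub> \<alpha> p"
    show "?\<beta> \<in> carrier (two_cocycles G M)"
    proof (rule two_cocyclesI)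
      fix g h k assume [simp]: "g \<in> carrier G" "h \<in> carrier G" "k \<in> carrier G"
      have "inv\<^bsub>M\<^esub> (\<alpha> (g, h) \<otimes>\<^bsub>M\<^esub> \<alpha> (g \<otimes> h, k)) = inv\<^bsub>M\<^esub> (\<alpha> (h, k) \<otimes>\<^bsub>M\<^esub> \<alpha> (g, h \<otimes> k))"
        using \<alpha> by (simp add: two_cocycle_eq)
      then show "?\<beta> (g, h) \<otimes>\<^bsub>M\<^esub> ?\<beta> (g \<otimes> h, k) = ?\<beta> (h, k) \<otimes>\<^bsub>M\<^esub> ?\<beta> (g, h \<otimes> k)"
        using \<alpha> by (simp add: M.inv_mult)
    qed (use \<alpha> in auto)
    show "?\<beta> \<otimes>\<^bsub>two_cocycles G M\<^esub> \<alpha> = \<one>\<^bsub>two_cocycles G M\<^esub>"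
      by (rule two_cocycle_eqI) (use \<alpha> in \<open>auto simp: extensional_simps\<close>)
  qed
  show "\<one>\<^bsub>two_cocycles G M\<^esub> \<in> carrier (two_cocycles G M)"
    by (rule two_cocyclesI) (auto simp: extensional_simps)
qed (auto intro!: two_cocycle_eqI simp: extensional_simps M.m_ac)

sublocale Z: comm_group "two_cocycles G M" by (rule comm_group_two_cocycles)

lemma coboundary_closed:
  assumes c: "c \<in> carrier G \<rightarrow> carrier M"
  shows "coboundary c \<in> carrier (two_cocycles G M)"
proof (rule two_cocyclesI)
  have [simp]: "c g \<in> carrier M" if "g \<in> carrier G" for g using c that by blast
  fix g h k assume [simp]: "g \<in> carrier G" "h \<in> carrier G" "k \<in> carrier G"
  show "coboundary c (g, h) \<in> carrier M" by simp
  \<comment> \<open>On either side the value of \<open>c\<close> at the intermediate product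
    cancels, which leaves the same expression in \<open>g\<close>, \<open>h\<close>,
    \<open>k\<close> and their product.\<close>
  have "coboundary c (g, h) \<otimes>\<^bsub>M\<^esub> coboundary c (g \<otimes> h, k)
      = c g \<otimes>\<^bsub>M\<^esub> c h \<otimes>\<^bsub>M\<^esub> c k \<otimes>\<^bsub>M\<^esub> inv\<^bsub>M\<^esub> c (g \<otimes> (h \<otimes> k))"
    by (simp add: M.m_ac M.inv_mult_cancel G.m_assoc)
  moreover have "coboundary c (h, k) \<otimes>\<^bsub>M\<^esub> coboundary c (g, h \<otimes> k)
      = c g \<otimes>\<^bsub>M\<^esub> c h \<otimes>\<^bsub>M\<^esub> c k \<otimes>\<^bsub>M\<^esub> inv\<^bsub>M\<^esub> c (g \<otimes> (h \<otimes> k))"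
    by (simp add: M.m_ac M.inv_mult_cancel)
  ultimately show "coboundary c (g, h) \<otimes>\<^bsub>M\<^esub> coboundary c (g \<otimes> h, k)
      = coboundary c (h, k) \<otimes>\<^bsub>M\<^esub> coboundary c (g, h \<otimes> k)"
    by simp
qed (simp add: coboundary_def)

lemma coboundary_mult:
  assumes "c \<in> carrier G \<rightarrow> carrier M" "d \<in> carrier G \<rightarrow> carrier M"
  shows "coboundary c \<otimes>\<^bsub>two_cocycles G M\<^esub> coboundary d = coboundary (\<lambda>g. c g \<otimes>\<^bsub>M\<^esub> d g)"
proof -
  have [simp]: "c g \<in> carrier M" "d g \<in> carrier M" if "g \<in> carrier G" for g using assms that by blast+
  show ?thesis
    by (rule two_cocycle_eqI)
      (auto simp: coboundary_def mult_two_cocycles_extensional M.m_ac M.inv_mult)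
qed

lemma subgroup_two_coboundaries: "subgroup (two_coboundaries G M) (two_cocycles G M)"
proof (rule Z.subgroupI)
  show "two_coboundaries G M \<subseteq> carrier (two_cocycles G M)"
    by (auto simp: two_coboundaries_eq coboundary_closed)
  show "two_coboundaries G M \<noteq> {}"
    by (auto simp: two_coboundaries_eq intro!: exI[of _ "\<lambda>_. \<one>\<^bsub>M\<^esub>"])
  show "b \<otimes>\<^bsub>two_cocycles G M\<^esub> b' \<in> two_coboundaries G M"
    if "b \<in> two_coboundaries G M" "b' \<in> two_coboundaries G M" for b b'
    using that by (auto simp: two_coboundaries_eq coboundary_mult Pi_def intro!: imageI)
  show "inv\<^bsub>two_cocycles G M\<^esub> b \<in> two_coboundaries G M" if "b \<in> two_coboundaries G M" for b
  proof -
    obtain c where c: "c \<in> carrier G \<rightarrow> carrier M" "b = coboundary c"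
      using \<open>b \<in> two_coboundaries G M\<close> by (auto simp: two_coboundaries_eq)
    have [simp]: "c g \<in> carrier M" if "g \<in> carrier G" for g using c that by blast
    define d where "d = (\<lambda>g. inv\<^bsub>M\<^esub> c g)"
    have d: "d \<in> carrier G \<rightarrow> carrier M" by (simp add: d_def)
    have "coboundary d \<otimes>\<^bsub>two_cocycles G M\<^esub> coboundary c = \<one>\<^bsub>two_cocycles G M\<^esub>"
      unfolding coboundary_mult[OF d c(1)]
      by (rule two_cocycle_eqI) (auto simp: d_def coboundary_def one_two_cocycles_extensional)
    then have "inv\<^bsub>two_cocycles G M\<^esub> b = coboundary d"
      using c d by (intro Z.inv_equality) (auto simp: coboundary_closed)
    then show ?thesis using d by (auto simp: two_coboundaries_eq)
  qed
qed

sublocale B: normal "two_coboundaries G M" "two_cocycles G M"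
  by (intro Z.subgroup_imp_normal subgroup_two_coboundaries)

text \<open>Injectivity of the transgression extracts a cochain from equal classes, and surjectivity
  exhibits one; both work with the pointwise equation.\<close>

lemma coboundary_coset_eq_iff:
  assumes "\<alpha> \<in> carrier (two_cocycles G M)" "\<beta> \<in> carrier (two_cocycles G M)"
  shows "two_coboundaries G M #>\<^bsub>two_cocycles G M\<^esub> \<alpha> = two_coboundaries G M #>\<^bsub>two_cocycles G M\<^esub> \<beta>
    \<longleftrightarrow> (\<exists>c\<in>carrier G \<rightarrow> carrier M. \<forall>g\<in>carrier G. \<forall>h\<in>carrier G.
          \<alpha> (g, h) = coboundary c (g, h) \<otimes>\<^bsub>M\<^esub> \<beta> (g, h))" (is "?L \<longleftrightarrow> ?R")
proof
  assume ?L
  then have "\<alpha> \<in> two_coboundaries G M #>\<^bsub>two_cocycles G M\<^esub> \<beta>"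
    using Z.rcos_self[OF assms(1) subgroup_two_coboundaries] by simp
  then obtain c where "c \<in> carrier G \<rightarrow> carrier M" "\<alpha> = coboundary c \<otimes>\<^bsub>two_cocycles G M\<^esub> \<beta>"
    by (auto simp: r_coset_def two_coboundaries_eq)
  then show ?R by (intro bexI[of _ c]) auto
next
  assume ?R
  then obtain c where c: "c \<in> carrier G \<rightarrow> carrier M"
    and *: "\<And>g h. g \<in> carrier G \<Longrightarrow> h \<in> carrier G \<Longrightarrow> \<alpha> (g, h) = coboundary c (g, h) \<otimes>\<^bsub>M\<^esub> \<beta> (g, h)"
    by blast
  have "\<alpha> = coboundary c \<otimes>\<^bsub>two_cocycles G M\<^esub> \<beta>"
    by (rule two_cocycle_eqI) (use assms in \<open>auto simp: extensional_simps * simp del: coboundary_apply\<close>)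
  then have "\<alpha> \<in> two_coboundaries G M #>\<^bsub>two_cocycles G M\<^esub> \<beta>"
    using c by (auto simp: r_coset_def two_coboundaries_eq)
  then show ?L using Z.repr_independence[OF _ assms(2) subgroup_two_coboundaries] by simp
qed

end


section \<open>Central extensions and transgression\<close>

context trivial_module
begin

text \<open>The central extension of \<open>G\<close> by \<open>M\<close> with factor set
  \<open>\<alpha>\<close>. Cocycles are not assumed normalized, hence the value
  \<open>\<alpha> (\<one>, \<one>)\<close> in the unit.\<close>

definition extension_group :: "('g \<times> 'g \<Rightarrow> 'm) \<Rightarrow> ('g \<times> 'm) monoid" where
  "extension_group \<alpha> = \<lparr>
     carrier = carrier G \<times> carrier M,
     monoid.mult = (\<lambda>(g, u) (h, v). (g \<otimes> h, u \<otimes>\<^bsub>M\<^esub> v \<otimes>\<^bsub>M\<^esub> \<alpha> (g, h))),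
     one = (\<one>, inv\<^bsub>M\<^esub> \<alpha> (\<one>, \<one>))\<rparr>"

lemma extension_group_simps [simp]:
  "carrier (extension_group \<alpha>) = carrier G \<times> carrier M"
  "(g, u) \<otimes>\<^bsub>extension_group \<alpha>\<^esub> (h, v) = (g \<otimes> h, u \<otimes>\<^bsub>M\<^esub> v \<otimes>\<^bsub>M\<^esub> \<alpha> (g, h))"
  "\<one>\<^bsub>extension_group \<alpha>\<^esub> = (\<one>, inv\<^bsub>M\<^esub> \<alpha> (\<one>, \<one>))"
  by (simp_all add: extension_group_def)

context
  fixes \<alpha> assumes \<alpha> [simp]: "\<alpha> \<in> carrier (two_cocycles G M)"
begin

text \<open>The cocycle identity at \<open>\<one>\<close>, \<open>\<one>\<close>, \<open>g\<close>
  cancels to this. Together with its mirror image it replaces normalization of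
  \<open>\<alpha>\<close>.\<close>

lemma two_cocycle_one_left: "g \<in> carrier G \<Longrightarrow> \<alpha> (\<one>, g) = \<alpha> (\<one>, \<one>)"
  using two_cocycle_eq[OF \<alpha>, of \<one> \<one> g] by simp

lemma two_cocycle_one_right: "g \<in> carrier G \<Longrightarrow> \<alpha> (g, \<one>) = \<alpha> (\<one>, \<one>)"
  using two_cocycle_eq[OF \<alpha>, of g \<one> \<one>] by simp

lemma group_extension_group: "group (extension_group \<alpha>)"
proof (rule groupI)
  show "a \<otimes>\<^bsub>extension_group \<alpha>\<^esub> b \<otimes>\<^bsub>extension_group \<alpha>\<^esub> c
      = a \<otimes>\<^bsub>extension_group \<alpha>\<^esub> (b \<otimes>\<^bsub>extension_group \<alpha>\<^esub> c)"
    if "a \<in> carrier (extension_group \<alpha>)" "b \<in> carrier (extension_group \<alpha>)"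
      "c \<in> carrier (extension_group \<alpha>)" for a b c
  proof -
    obtain g u h v k w where [simp]: "a = (g, u)" "b = (h, v)" "c = (k, w)"
      by (metis surj_pair)
    have [simp]: "g \<in> carrier G" "h \<in> carrier G" "k \<in> carrier G"
      "u \<in> carrier M" "v \<in> carrier M" "w \<in> carrier M"
      using that by auto
    have "u \<otimes>\<^bsub>M\<^esub> v \<otimes>\<^bsub>M\<^esub> w \<otimes>\<^bsub>M\<^esub> (\<alpha> (g, h) \<otimes>\<^bsub>M\<^esub> \<alpha> (g \<otimes> h, k))
        = u \<otimes>\<^bsub>M\<^esub> v \<otimes>\<^bsub>M\<^esub> w \<otimes>\<^bsub>M\<^esub> (\<alpha> (h, k) \<otimes>\<^bsub>M\<^esub> \<alpha> (g, h \<otimes> k))"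
      by (simp add: two_cocycle_eq)
    then show ?thesis by (simp add: M.m_ac G.m_assoc)
  qed
  show "\<exists>b\<in>carrier (extension_group \<alpha>). b \<otimes>\<^bsub>extension_group \<alpha>\<^esub> a = \<one>\<^bsub>extension_group \<alpha>\<^esub>"
    if a: "a \<in> carrier (extension_group \<alpha>)" for a
  proof -
    obtain g u where [simp]: "a = (g, u)" "g \<in> carrier G" "u \<in> carrier M" using a by auto
    \<comment> \<open>\<open>w\<close> is chosen so that \<open>(inv g, w)\<close> times
      \<open>a\<close> has the second component of the unit, the inverse of
      \<open>\<alpha> (\<one>, \<one>)\<close>.\<close>
    define w where "w = inv\<^bsub>M\<^esub> \<alpha> (\<one>, \<one>) \<otimes>\<^bsub>M\<^esub> inv\<^bsub>M\<^esub> (u \<otimes>\<^bsub>M\<^esub> \<alpha> (inv g, g))"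
    have "w \<otimes>\<^bsub>M\<^esub> u \<otimes>\<^bsub>M\<^esub> \<alpha> (inv g, g) = inv\<^bsub>M\<^esub> \<alpha> (\<one>, \<one>)"
      by (simp add: w_def M.m_assoc)
    moreover have "w \<in> carrier M" by (simp add: w_def)
    ultimately show ?thesis by (intro bexI[of _ "(inv g, w)"]) auto
  qed
next
  fix a assume "a \<in> carrier (extension_group \<alpha>)"
  then obtain g u where "a = (g, u)" "g \<in> carrier G" "u \<in> carrier M" by auto
  then show "\<one>\<^bsub>extension_group \<alpha>\<^esub> \<otimes>\<^bsub>extension_group \<alpha>\<^esub> a = a"
    by (simp add: two_cocycle_one_left[of g] M.m_ac M.inv_mult_cancel)
qed auto

lemma fst_extension_group_hom: "fst \<in> hom (extension_group \<alpha>) G"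
  by (rule homI) auto

text \<open>If \<open>a\<close> has first component \<open>\<one>\<close>, both orders of the
  product pick up the same factor \<open>\<alpha> (\<one>, \<one>)\<close>.\<close>

lemma extension_group_kernel_central:
  assumes "a \<in> carrier (extension_group \<alpha>)" "b \<in> carrier (extension_group \<alpha>)" "fst a = \<one>"
  shows "a \<otimes>\<^bsub>extension_group \<alpha>\<^esub> b = b \<otimes>\<^bsub>extension_group \<alpha>\<^esub> a"
proof -
  obtain u h v where "a = (\<one>, u)" "b = (h, v)" "h \<in> carrier G" "u \<in> carrier M" "v \<in> carrier M"
    using assms by (cases a, cases b) auto
  then show ?thesis
    by (simp add: two_cocycle_one_left[of h] two_cocycle_one_right[of h] M.m_ac)
qed

end

end

section \<open>The factor set of a section, and the transgression\<close>

locale sectioned_central_extension = trivial_module G M + A: group A + E: group E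
  for G :: "('g, 'z) monoid_scheme" (structure) and M :: "('m, 'w) monoid_scheme"
    and A :: "('a, 'x) monoid_scheme" and E :: "('e, 'y) monoid_scheme" +
  fixes i :: "'a \<Rightarrow> 'e" and p :: "'e \<Rightarrow> 'g" and \<mu> :: "'g \<Rightarrow> 'e"
  assumes extension: "central_extension A i E p G" and sect: "set_section E p G \<mu>"
begin

sublocale p: group_hom E G p
  using extension by unfold_locales (auto simp: central_extension_def epi_def)

sublocale i: group_hom A E i
  using extension by unfold_locales (auto simp: central_extension_def mon_def)

lemma \<mu>_closed [simp]: "g \<in> carrier G \<Longrightarrow> \<mu> g \<in> carrier E"
  and p_\<mu> [simp]: "g \<in> carrier G \<Longrightarrow> p (\<mu> g) = g"
  using sect by (auto simp: set_section_def)

lemma i_central: "a \<in> carrier A \<Longrightarrow> e \<in> carrier E \<Longrightarrow> i a \<otimes>\<^bsub>E\<^esub> e = e \<otimes>\<^bsub>E\<^esub> i a"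
  using extension by (auto simp: central_extension_def)

lemma inj_i: "inj_on i (carrier A)"
  using extension by (auto simp: central_extension_def mon_def)

lemma p_i [simp]: "a \<in> carrier A \<Longrightarrow> p (i a) = \<one>"
  using extension by (auto simp: central_extension_def kernel_def)

text \<open>The \<open>A\<close>-coordinate of \<open>e\<close>: every element of \<open>E\<close>
  is uniquely \<open>i a\<close> times a section value.\<close>

definition part :: "'e \<Rightarrow> 'a" where
  "part e = inv_into (carrier A) i (e \<otimes>\<^bsub>E\<^esub> inv\<^bsub>E\<^esub> \<mu> (p e))"

lemma part:
  assumes "e \<in> carrier E"
  shows "part e \<in> carrier A" "i (part e) \<otimes>\<^bsub>E\<^esub> \<mu> (p e) = e"
proof -
  have "e \<otimes>\<^bsub>E\<^esub> inv\<^bsub>E\<^esub> \<mu> (p e) \<in> kernel E G p"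
    using assms by (simp add: kernel_def)
  then have *: "e \<otimes>\<^bsub>E\<^esub> inv\<^bsub>E\<^esub> \<mu> (p e) \<in> i ` carrier A"
    using extension by (simp add: central_extension_def)
  show "part e \<in> carrier A" unfolding part_def by (rule inv_into_into[OF *])
  show "i (part e) \<otimes>\<^bsub>E\<^esub> \<mu> (p e) = e"
    unfolding part_def f_inv_into_f[OF *] using assms by (simp add: E.m_assoc)
qed

lemma part_eqI:
  assumes "a \<in> carrier A" "g \<in> carrier G"
  shows "part (i a \<otimes>\<^bsub>E\<^esub> \<mu> g) = a"
  unfolding part_def using assms by (simp add: E.m_assoc inv_into_f_f[OF inj_i])

text \<open>The factor set of the extension itself, with values in \<open>A\<close>; the
  transgression composes it with homomorphisms from \<open>A\<close> to \<open>M\<close>.\<close>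

definition \<kappa> :: "'g \<Rightarrow> 'g \<Rightarrow> 'a" where "\<kappa> g h = part (\<mu> g \<otimes>\<^bsub>E\<^esub> \<mu> h)"

lemma \<kappa>:
  assumes "g \<in> carrier G" "h \<in> carrier G"
  shows "\<kappa> g h \<in> carrier A" "\<mu> g \<otimes>\<^bsub>E\<^esub> \<mu> h = i (\<kappa> g h) \<otimes>\<^bsub>E\<^esub> \<mu> (g \<otimes> h)"
  unfolding \<kappa>_def using part[of "\<mu> g \<otimes>\<^bsub>E\<^esub> \<mu> h"] assms by auto

text \<open>The element \<open>i (part e')\<close> is central, so it can be moved past
  \<open>\<mu> (p e)\<close>; the two section values left side by side contribute
  \<open>\<kappa>\<close>.\<close>

lemma part_mult:
  assumes [simp]: "e \<in> carrier E" "e' \<in> carrier E"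
  shows "part (e \<otimes>\<^bsub>E\<^esub> e') = part e \<otimes>\<^bsub>A\<^esub> part e' \<otimes>\<^bsub>A\<^esub> \<kappa> (p e) (p e')"
proof -
  have [simp]: "part e \<in> carrier A" "part e' \<in> carrier A" "\<kappa> (p e) (p e') \<in> carrier A"
    by (simp_all add: part \<kappa>)
  have "e \<otimes>\<^bsub>E\<^esub> e' = (i (part e) \<otimes>\<^bsub>E\<^esub> \<mu> (p e)) \<otimes>\<^bsub>E\<^esub> (i (part e') \<otimes>\<^bsub>E\<^esub> \<mu> (p e'))"
    by (simp add: part)
  also have "\<dots> = i (part e) \<otimes>\<^bsub>E\<^esub> (\<mu> (p e) \<otimes>\<^bsub>E\<^esub> i (part e')) \<otimes>\<^bsub>E\<^esub> \<mu> (p e')"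
    by (simp add: E.m_assoc)
  also have "\<dots> = i (part e) \<otimes>\<^bsub>E\<^esub> i (part e') \<otimes>\<^bsub>E\<^esub> (\<mu> (p e) \<otimes>\<^bsub>E\<^esub> \<mu> (p e'))"
    by (simp add: i_central[of "part e'" "\<mu> (p e)", symmetric] E.m_assoc)
  also have "\<dots> = i (part e \<otimes>\<^bsub>A\<^esub> part e' \<otimes>\<^bsub>A\<^esub> \<kappa> (p e) (p e')) \<otimes>\<^bsub>E\<^esub> \<mu> (p e \<otimes> p e')"
    by (simp add: \<kappa>(2) E.m_assoc)
  finally show ?thesis by (simp add: part_eqI del: i.hom_mult)
qed

text \<open>The two bracketings of a product of three section values have the same
  \<open>A\<close>-coordinate, and section values themselves have trivial
  \<open>A\<close>-coordinate.\<close>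

lemma \<kappa>_cocycle:
  assumes [simp]: "g \<in> carrier G" "h \<in> carrier G" "k \<in> carrier G"
  shows "\<kappa> g h \<otimes>\<^bsub>A\<^esub> \<kappa> (g \<otimes> h) k = \<kappa> h k \<otimes>\<^bsub>A\<^esub> \<kappa> g (h \<otimes> k)"
proof -
  have part_\<mu>: "part (\<mu> g) = \<one>\<^bsub>A\<^esub>" if "g \<in> carrier G" for g
    using part_eqI[of "\<one>\<^bsub>A\<^esub>" g] that by simp
  have "part (\<mu> g \<otimes>\<^bsub>E\<^esub> \<mu> h \<otimes>\<^bsub>E\<^esub> \<mu> k) = part (\<mu> g \<otimes>\<^bsub>E\<^esub> (\<mu> h \<otimes>\<^bsub>E\<^esub> \<mu> k))"
    by (simp add: E.m_assoc)
  then show ?thesis by (simp add: part_mult part_\<mu> \<kappa>(1))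
qed

definition factor_set :: "('a \<Rightarrow> 'm) \<Rightarrow> 'g \<times> 'g \<Rightarrow> 'm" where
  "factor_set f = (\<lambda>(g, h)\<in>carrier G \<times> carrier G. f (\<kappa> g h))"

lemma factor_set_apply [simp]:
  "g \<in> carrier G \<Longrightarrow> h \<in> carrier G \<Longrightarrow> factor_set f (g, h) = f (\<kappa> g h)"
  by (simp add: factor_set_def)

lemma transgression_eq:
  "transgression A i E G M \<mu> f = two_coboundaries G M #>\<^bsub>two_cocycles G M\<^esub> factor_set f"
  unfolding transgression_def factor_set_def
  by (intro arg_cong[where f = "\<lambda>\<alpha>. two_coboundaries G M #>\<^bsub>two_cocycles G M\<^esub> \<alpha>"] restrict_ext)
    (clarsimp simp: \<kappa>_def part_def)

lemma factor_set_closed: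
  assumes "f \<in> hom A M"
  shows "factor_set f \<in> carrier (two_cocycles G M)"
proof -
  interpret f: group_hom A M f by unfold_locales fact
  show ?thesis
  proof (rule two_cocyclesI)
    fix g h k assume "g \<in> carrier G" "h \<in> carrier G" "k \<in> carrier G"
    then show "factor_set f (g, h) \<otimes>\<^bsub>M\<^esub> factor_set f (g \<otimes> h, k)
        = factor_set f (h, k) \<otimes>\<^bsub>M\<^esub> factor_set f (g, h \<otimes> k)"
      by (simp add: \<kappa>(1) \<kappa>_cocycle flip: f.hom_mult)
  qed (auto simp: factor_set_def \<kappa>(1))
qed

lemma transgression_hom: "transgression A i E G M \<mu> \<in> hom (Hom_group A M) (H2 G M)"
proof (rule homI)
  fix f assume "f \<in> carrier (Hom_group A M)"
  then have "f \<in> hom A M" by (simp add: Hom_group_def)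
  then show "transgression A i E G M \<mu> f \<in> carrier (H2 G M)"
    by (simp add: transgression_eq H2_def FactGroup_def Z.rcosetsI B.subset factor_set_closed)
next
  fix f f' assume "f \<in> carrier (Hom_group A M)" "f' \<in> carrier (Hom_group A M)"
  then have f: "f \<in> hom A M" "f' \<in> hom A M" by (auto simp: Hom_group_def)
  have "factor_set (f \<otimes>\<^bsub>Hom_group A M\<^esub> f') = factor_set f \<otimes>\<^bsub>two_cocycles G M\<^esub> factor_set f'"
    by (rule two_cocycle_eqI)
      (auto simp: mult_two_cocycles_extensional factor_set_def Hom_group_def \<kappa>(1))
  then show "transgression A i E G M \<mu> (f \<otimes>\<^bsub>Hom_group A M\<^esub> f') =
      transgression A i E G M \<mu> f \<otimes>\<^bsub>H2 G M\<^esub> transgression A i E G M \<mu> f'"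
    using f by (simp add: transgression_eq H2_def FactGroup_def B.rcos_sum factor_set_closed)
qed

text \<open>If \<open>f\<close> and \<open>f'\<close> transgress to the same class, their quotient
  extends from \<open>A\<close> to a homomorphism on all of \<open>E\<close>, and
  \<open>trivial\<close> then makes the quotient trivial on \<open>A\<close>.\<close>

lemma transgression_inj:
  assumes trivial: "\<And>F a. F \<in> hom E M \<Longrightarrow> a \<in> carrier A \<Longrightarrow> F (i a) = \<one>\<^bsub>M\<^esub>"
  shows "inj_on (transgression A i E G M \<mu>) (carrier (Hom_group A M))"
proof (rule inj_onI)
  fix f f'
  assume f_in: "f \<in> carrier (Hom_group A M)" "f' \<in> carrier (Hom_group A M)"
    and eq: "transgression A i E G M \<mu> f = transgression A i E G M \<mu> f'"
  then have homs: "f \<in> hom A M" "f' \<in> hom A M" by (auto simp: Hom_group_def)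
  interpret f: group_hom A M f by unfold_locales fact
  interpret f': group_hom A M f' by unfold_locales fact
  obtain c where c: "c \<in> carrier G \<rightarrow> carrier M" and fc:
    "\<And>g h. g \<in> carrier G \<Longrightarrow> h \<in> carrier G \<Longrightarrow> f (\<kappa> g h) = coboundary c (g, h) \<otimes>\<^bsub>M\<^esub> f' (\<kappa> g h)"
    using eq by (auto simp: transgression_eq coboundary_coset_eq_iff factor_set_closed homs)
  have [simp]: "c g \<in> carrier M" if "g \<in> carrier G" for g using c that by blast
  define h where "h = (\<lambda>a. f a \<otimes>\<^bsub>M\<^esub> inv\<^bsub>M\<^esub> f' a)"
  have h_mult: "h (a \<otimes>\<^bsub>A\<^esub> b) = h a \<otimes>\<^bsub>M\<^esub> h b" if "a \<in> carrier A" "b \<in> carrier A" for a b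
    using that by (simp add: h_def M.inv_mult M.m_ac)
  have h_closed [simp]: "h a \<in> carrier M" if "a \<in> carrier A" for a
    using that by (simp add: h_def)
  have h_\<kappa>: "h (\<kappa> g g') \<otimes>\<^bsub>M\<^esub> c (g \<otimes> g') = c g \<otimes>\<^bsub>M\<^esub> c g'"
    if "g \<in> carrier G" "g' \<in> carrier G" for g g'
    using that by (simp add: h_def fc \<kappa>(1) M.m_assoc)
  \<comment> \<open>The product of \<open>i a\<close> and \<open>\<mu> g\<close> is sent to
    \<open>h a\<close> times \<open>c g\<close>. The equation \<open>h_\<kappa>\<close> is exactly
    what makes this multiplicative.\<close>
  define F where "F = (\<lambda>e. h (part e) \<otimes>\<^bsub>M\<^esub> c (p e))"
  have F: "F \<in> hom E M"
  proof (rule homI)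
    fix e e' assume [simp]: "e \<in> carrier E" "e' \<in> carrier E"
    have "F (e \<otimes>\<^bsub>E\<^esub> e') = h (part e) \<otimes>\<^bsub>M\<^esub> h (part e') \<otimes>\<^bsub>M\<^esub>
        (h (\<kappa> (p e) (p e')) \<otimes>\<^bsub>M\<^esub> c (p e \<otimes> p e'))"
      by (simp add: F_def part_mult h_mult part(1) \<kappa>(1) M.m_assoc)
    then show "F (e \<otimes>\<^bsub>E\<^esub> e') = F e \<otimes>\<^bsub>M\<^esub> F e'"
      by (simp add: F_def h_\<kappa> part(1) M.m_ac)
  qed (auto simp: F_def part(1))
  have "f a = f' a" if a [simp]: "a \<in> carrier A" for a
  proof -
    have [simp]: "part (i a) \<in> carrier A" "\<kappa> \<one> \<one> \<in> carrier A" by (simp_all add: part \<kappa>)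
    \<comment> \<open>The section need not send \<open>\<one>\<close> to the unit, so
      \<open>part (i a)\<close> may differ from \<open>a\<close> by the factor
      \<open>\<kappa> \<one> \<one>\<close>; the value \<open>c \<one>\<close> accounts for
      it.\<close>
    have "\<mu> \<one> = i (\<kappa> \<one> \<one>)"
      using \<kappa>(2)[of \<one> \<one>] by simp
    then have "i (part (i a) \<otimes>\<^bsub>A\<^esub> \<kappa> \<one> \<one>) = i a"
      using part(2)[of "i a"] by simp
    then have "part (i a) \<otimes>\<^bsub>A\<^esub> \<kappa> \<one> \<one> = a"
      using inj_onD[OF inj_i] by simp
    then have "h a = h (part (i a)) \<otimes>\<^bsub>M\<^esub> h (\<kappa> \<one> \<one>)"
      using h_mult[of "part (i a)" "\<kappa> \<one> \<one>"] by simp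
    also have "h (\<kappa> \<one> \<one>) = c \<one>" using h_\<kappa>[of \<one> \<one>] by simp
    also have "h (part (i a)) \<otimes>\<^bsub>M\<^esub> c \<one> = F (i a)" by (simp add: F_def)
    finally have "h a = \<one>\<^bsub>M\<^esub>" using trivial[OF F a] by simp
    then show "f a = f' a"
      using a by (simp add: h_def M.inv_solve_right')
  qed
  then show "f = f'"
    using f_in by (intro extensionalityI[of f "carrier A" f']) (auto simp: Hom_group_def)
qed

text \<open>A lift \<open>\<phi>\<close> of \<open>p\<close> to the extension given by
  \<open>\<alpha>\<close> yields, on \<open>A\<close>, a homomorphism to \<open>M\<close>. Evaluated
  on the section, it yields the cochain comparing the resulting factor set with
  \<open>\<alpha>\<close>.\<close>

lemma transgression_surj:
  assumes lift: "\<And>\<alpha>. \<alpha> \<in> carrier (two_cocycles G M) \<Longrightarrow>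
    \<exists>\<phi>\<in>hom E (extension_group \<alpha>). \<forall>e\<in>carrier E. fst (\<phi> e) = p e"
  shows "carrier (H2 G M) \<subseteq> transgression A i E G M \<mu> ` carrier (Hom_group A M)"
proof
  fix x assume "x \<in> carrier (H2 G M)"
  then obtain \<alpha> where \<alpha> [simp]: "\<alpha> \<in> carrier (two_cocycles G M)"
    and x: "x = two_coboundaries G M #>\<^bsub>two_cocycles G M\<^esub> \<alpha>"
    by (auto simp: H2_def FactGroup_def RCOSETS_def)
  obtain \<phi> where \<phi>: "\<phi> \<in> hom E (extension_group \<alpha>)" and fst_\<phi>: "\<And>e. e \<in> carrier E \<Longrightarrow> fst (\<phi> e) = p e"
    using lift[OF \<alpha>] by blast
  have \<phi>_eq: "\<phi> e = (p e, snd (\<phi> e))" if "e \<in> carrier E" for e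
    using fst_\<phi>[OF that] by (metis prod.collapse)
  have snd_closed [simp]: "snd (\<phi> e) \<in> carrier M" if "e \<in> carrier E" for e
    using hom_in_carrier[OF \<phi> that] by auto
  have snd_mult: "snd (\<phi> (e \<otimes>\<^bsub>E\<^esub> e')) = snd (\<phi> e) \<otimes>\<^bsub>M\<^esub> snd (\<phi> e') \<otimes>\<^bsub>M\<^esub> \<alpha> (p e, p e')"
    if "e \<in> carrier E" "e' \<in> carrier E" for e e'
    using hom_mult[OF \<phi> that] \<phi>_eq[OF that(1)] \<phi>_eq[OF that(2)]
    by (metis extension_group_simps(2) snd_conv)
  \<comment> \<open>The factor \<open>\<alpha> (\<one>, \<one>)\<close> makes \<open>f\<close>
    multiplicative although \<open>\<alpha>\<close> need not be normalized: on the image of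
    \<open>i\<close>, each use of \<open>snd_mult\<close> adds one such factor.\<close>
  define f where "f = (\<lambda>a\<in>carrier A. snd (\<phi> (i a)) \<otimes>\<^bsub>M\<^esub> \<alpha> (\<one>, \<one>))"
  define c where "c = (\<lambda>g. snd (\<phi> (\<mu> g)))"
  have c: "c \<in> carrier G \<rightarrow> carrier M" by (simp add: c_def)
  have f: "f \<in> hom A M"
    by (rule homI) (auto simp: f_def snd_mult M.m_ac)
  have "f (\<kappa> g h) = coboundary c (g, h) \<otimes>\<^bsub>M\<^esub> \<alpha> (g, h)"
    if [simp]: "g \<in> carrier G" "h \<in> carrier G" for g h
  proof -
    have [simp]: "\<kappa> g h \<in> carrier A" by (simp add: \<kappa>)
    \<comment> \<open>The second component of \<open>\<phi>\<close> at the product of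
      \<open>\<mu> g\<close> and \<open>\<mu> h\<close> is computed twice: from the two factors, and
      from \<open>\<kappa> g h\<close>.\<close>
    have "c g \<otimes>\<^bsub>M\<^esub> c h \<otimes>\<^bsub>M\<^esub> \<alpha> (g, h) = snd (\<phi> (i (\<kappa> g h) \<otimes>\<^bsub>E\<^esub> \<mu> (g \<otimes> h)))"
      using snd_mult[of "\<mu> g" "\<mu> h"] by (simp add: c_def \<kappa>(2))
    also have "\<dots> = f (\<kappa> g h) \<otimes>\<^bsub>M\<^esub> c (g \<otimes> h)"
      by (simp add: snd_mult f_def c_def two_cocycle_one_left[of \<alpha> "g \<otimes> h"] M.m_ac)
    finally have "f (\<kappa> g h) = c g \<otimes>\<^bsub>M\<^esub> c h \<otimes>\<^bsub>M\<^esub> \<alpha> (g, h) \<otimes>\<^bsub>M\<^esub> inv\<^bsub>M\<^esub> c (g \<otimes> h)"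
      by (simp add: c_def f_def M.m_assoc)
    then show ?thesis by (simp add: c_def M.m_ac)
  qed
  then have "x = transgression A i E G M \<mu> f"
    unfolding x transgression_eq
    by (intro coboundary_coset_eq_iff[THEN iffD2, symmetric]) (use c f in \<open>auto simp: factor_set_closed\<close>)
  moreover have "f \<in> carrier (Hom_group A M)" using f by (simp add: Hom_group_def f_def)
  ultimately show "x \<in> transgression A i E G M \<mu> ` carrier (Hom_group A M)" by blast
qed

text \<open>Isolates the two checks that involve the particular group \<open>E\<close>: the first
  gives injectivity, the second surjectivity.\<close>

lemma transgression_iso:
  assumes "\<And>F a. F \<in> hom E M \<Longrightarrow> a \<in> carrier A \<Longrightarrow> F (i a) = \<one>\<^bsub>M\<^esub>"
    and "\<And>\<alpha>. \<alpha> \<in> carrier (two_cocycles G M) \<Longrightarrow>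
      \<exists>\<phi>\<in>hom E (extension_group \<alpha>). \<forall>e\<in>carrier E. fst (\<phi> e) = p e"
  shows "transgression A i E G M \<mu> \<in> iso (Hom_group A M) (H2 G M)"
proof -
  have "transgression A i E G M \<mu> ` carrier (Hom_group A M) \<subseteq> carrier (H2 G M)"
    using transgression_hom by (auto simp: hom_def)
  then show ?thesis
    using transgression_hom transgression_inj transgression_surj assms
    unfolding iso_def bij_betw_def by auto
qed

end


section \<open>The relations of the representation group\<close>

lemma (in group) commutator_eq_iff:
  assumes "a \<in> carrier G" "b \<in> carrier G" "c \<in> carrier G"
  shows "a \<otimes> b \<otimes> inv a \<otimes> inv b = c \<longleftrightarrow> a \<otimes> b = c \<otimes> b \<otimes> a"
  using assms by (metis inv_closed inv_solve_right' m_closed)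

text \<open>The defining relations of \<open>Hhat\<close>, read in an arbitrary group. The
  commutator relations are written without inverses, in the form
  \<open>a \<otimes> b = c \<otimes> b \<otimes> a\<close> that the lemmas on powers take.\<close>

definition Hhat_tuple :: "('a, 'm) monoid_scheme \<Rightarrow> nat \<Rightarrow> nat \<Rightarrow> (hgen \<Rightarrow> 'a) \<Rightarrow> bool" where
  "Hhat_tuple G r t \<phi> \<longleftrightarrow> range \<phi> \<subseteq> carrier G \<and>
     \<phi> GX \<otimes>\<^bsub>G\<^esub> \<phi> GY = \<phi> GZ [^]\<^bsub>G\<^esub> t \<otimes>\<^bsub>G\<^esub> \<phi> GY \<otimes>\<^bsub>G\<^esub> \<phi> GX \<and>
     \<phi> GX \<otimes>\<^bsub>G\<^esub> \<phi> GZ = \<phi> GZ1 \<otimes>\<^bsub>G\<^esub> \<phi> GZ \<otimes>\<^bsub>G\<^esub> \<phi> GX \<and>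
     \<phi> GY \<otimes>\<^bsub>G\<^esub> \<phi> GZ = \<phi> GZ2 \<otimes>\<^bsub>G\<^esub> \<phi> GZ \<otimes>\<^bsub>G\<^esub> \<phi> GY \<and>
     \<phi> GX [^]\<^bsub>G\<^esub> r = \<one>\<^bsub>G\<^esub> \<and> \<phi> GY [^]\<^bsub>G\<^esub> r = \<one>\<^bsub>G\<^esub> \<and> \<phi> GZ [^]\<^bsub>G\<^esub> (r * t) = \<one>\<^bsub>G\<^esub> \<and>
     (\<forall>s. \<phi> GZ1 \<otimes>\<^bsub>G\<^esub> \<phi> s = \<phi> s \<otimes>\<^bsub>G\<^esub> \<phi> GZ1) \<and> (\<forall>s. \<phi> GZ2 \<otimes>\<^bsub>G\<^esub> \<phi> s = \<phi> s \<otimes>\<^bsub>G\<^esub> \<phi> GZ2)"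

lemma all_hgen_iff: "(\<forall>s. P s) \<longleftrightarrow> P GX \<and> P GY \<and> P GZ \<and> P GZ1 \<and> P GZ2"
  by (metis hgen.exhaust)

lemma (in group) Hhat_tuple_iff:
  assumes "\<And>s. \<phi> s \<in> carrier G"
  shows "Hhat_tuple G r t \<phi> \<longleftrightarrow>
    (\<forall>(u, v)\<in>Hhat_relations r t. eval_word G \<phi> u = eval_word G \<phi> v)"
proof -
  have "range \<phi> \<subseteq> carrier G" using assms by blast
  then show ?thesis
    using assms unfolding Hhat_tuple_def Hhat_relations_def Let_def all_hgen_iff
    by (auto simp: eval_gen_word eval_pow_word eval_comm_word commutator_eq_iff)
qed

abbreviation hgen_class :: "nat \<Rightarrow> nat \<Rightarrow> hgen \<Rightarrow> hgen gword set" where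
  "hgen_class r t s \<equiv> word_class (Hhat_relations r t) (gen_word s)"

lemma group_Hhat: "group (Hhat r t)"
  by (simp add: Hhat_def group_presented_group)

lemma Hhat_tuple_Hhat: "Hhat_tuple (Hhat r t) r t (hgen_class r t)"
  unfolding Hhat_def
  by (subst group.Hhat_tuple_iff[OF group_presented_group])
    (auto simp del: set_eq_iff dest!: eval_relation_presented_group)

lemma (in group) Hhat_hom:
  assumes "Hhat_tuple G r t \<phi>"
  obtains h where "h \<in> hom (Hhat r t) G"
    and "\<And>w. h (word_class (Hhat_relations r t) w) = eval_word G \<phi> w"
proof -
  have \<phi>: "\<phi> s \<in> carrier G" for s using assms by (auto simp: Hhat_tuple_def)
  then have "eval_word G \<phi> u = eval_word G \<phi> v" if "(u, v) \<in> Hhat_relations r t" for u v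
    using assms that by (auto simp: Hhat_tuple_iff)
  from presented_group_hom[OF \<phi> this] show ?thesis
    using that by (metis Hhat_def)
qed

lemma (in group_hom) hom_eval_word:
  assumes "\<And>s. \<phi> s \<in> carrier G"
  shows "h (eval_word G \<phi> w) = eval_word H (\<lambda>s. h (\<phi> s)) w"
  by (induction w) (auto simp: eval_word_Cons assms G.eval_word_closed)

lemma (in group_hom) subgroup_preimage:
  assumes "subgroup S H"
  shows "subgroup {g \<in> carrier G. h g \<in> S} G"
  by (rule G.subgroupI) (auto simp: subgroup.m_closed[OF assms] subgroup.m_inv_closed[OF assms]
      subgroup.one_closed[OF assms] intro!: exI[of _ \<one>])

text \<open>A collection process: moving \<open>x [^] i\<close> past \<open>y [^] j\<close> costs
  only a power of \<open>z\<close> with exponent \<open>int t * (i * j)\<close>, and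
  \<open>z\<close> commutes with both, so a product of sorted expressions can be sorted
  again.\<close>

lemma (in group) heisenberg_normal_form_subgroup:
  assumes [simp]: "x \<in> carrier G" "y \<in> carrier G" "z \<in> carrier G"
    and xy: "x \<otimes> y = z [^] (t::nat) \<otimes> y \<otimes> x" and xz: "x \<otimes> z = z \<otimes> x" and yz: "y \<otimes> z = z \<otimes> y"
  shows "subgroup {y [^] j \<otimes> x [^] i \<otimes> z [^] k | (i::int) (j::int) (k::int). True} G" (is "subgroup ?S G")
proof -
  have swap: "x [^] i \<otimes> y [^] j = y [^] j \<otimes> x [^] i \<otimes> z [^] (int t * (i * j))" for i j :: int
  proof -
    have "x \<otimes> z [^] t = z [^] t \<otimes> x" "y \<otimes> z [^] t = z [^] t \<otimes> y"
      by (simp_all add: commutes_nat_pow xz yz)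
    then have "x [^] i \<otimes> y [^] j = (z [^] t) [^] (i * j) \<otimes> y [^] j \<otimes> x [^] i"
      by (intro int_pow_mult_int_pow_eq xy) simp_all
    also have "(z [^] t) [^] (i * j) = z [^] (int t * (i * j))"
      by (simp add: int_pow_pow flip: int_pow_int)
    also have "z [^] (int t * (i * j)) \<otimes> y [^] j = y [^] j \<otimes> z [^] (int t * (i * j))"
      using yz by (intro commutes_int_pow commutes_int_pow[symmetric]) simp_all
    also have "y [^] j \<otimes> z [^] (int t * (i * j)) \<otimes> x [^] i
        = y [^] j \<otimes> (z [^] (int t * (i * j)) \<otimes> x [^] i)"
      by (simp add: m_assoc)
    also have "z [^] (int t * (i * j)) \<otimes> x [^] i = x [^] i \<otimes> z [^] (int t * (i * j))"
      using xz by (intro commutes_int_pow commutes_int_pow[symmetric]) simp_all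
    finally show ?thesis by (simp add: m_assoc)
  qed
  have swap_z: "z [^] k \<otimes> y [^] j = y [^] j \<otimes> z [^] k" "z [^] k \<otimes> x [^] i = x [^] i \<otimes> z [^] k"
    for i j k :: int
    using xz yz by (auto intro!: commutes_int_pow commutes_int_pow[symmetric])
  \<comment> \<open>The trailing factor \<open>u\<close> lets these rules act inside right-nested
    products. They move powers of \<open>y\<close> to the front and powers of \<open>z\<close> to
    the back.\<close>
  have sort: "z [^] k \<otimes> (y [^] j \<otimes> u) = y [^] j \<otimes> (z [^] k \<otimes> u)"
    "z [^] k \<otimes> (x [^] i \<otimes> u) = x [^] i \<otimes> (z [^] k \<otimes> u)"
    "x [^] i \<otimes> (y [^] j \<otimes> u) = y [^] j \<otimes> (x [^] i \<otimes> (z [^] (int t * (i * j)) \<otimes> u))"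
    if [simp]: "u \<in> carrier G" for i j k :: int and u
    by (simp_all add: swap swap_z flip: m_assoc)
  have mult: "a \<otimes> b \<in> ?S" if ab: "a \<in> ?S" "b \<in> ?S" for a b
  proof -
    obtain i j k i' j' k' :: int where a: "a = y [^] j \<otimes> x [^] i \<otimes> z [^] k"
      and b: "b = y [^] j' \<otimes> x [^] i' \<otimes> z [^] k'"
      using ab by blast
    have "a \<otimes> b = y [^] (j + j') \<otimes> x [^] (i + i') \<otimes> z [^] (int t * (i * j') + (k + k'))"
      by (simp add: a b m_assoc sort int_pow_mult)
    then show ?thesis by blast
  qed
  have "x [^] i \<in> ?S" "y [^] i \<in> ?S" "z [^] i \<in> ?S" for i :: int
  proof -
    have "x [^] i = y [^] (0::int) \<otimes> x [^] i \<otimes> z [^] (0::int)"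
      "y [^] i = y [^] i \<otimes> x [^] (0::int) \<otimes> z [^] (0::int)"
      "z [^] i = y [^] (0::int) \<otimes> x [^] (0::int) \<otimes> z [^] i"
      by simp_all
    then show "x [^] i \<in> ?S" "y [^] i \<in> ?S" "z [^] i \<in> ?S" by blast+
  qed
  note powers = this
  show ?thesis
  proof (rule subgroupI)
    show "inv a \<in> ?S" if "a \<in> ?S" for a
    proof -
      obtain i j k :: int where a: "a = y [^] j \<otimes> x [^] i \<otimes> z [^] k"
        using \<open>a \<in> ?S\<close> by blast
      \<comment> \<open>The inverse is a product of three powers in reverse order, each of them in
        the set, so closure under products suffices.\<close>
      have "inv a = z [^] (- k) \<otimes> (x [^] (- i) \<otimes> y [^] (- j))"
        by (simp add: a inv_mult_group int_pow_neg)
      then show ?thesis by (simp only: mult powers)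
    qed
    show "?S \<noteq> {}" using powers by blast
  qed (use mult in auto)
qed

context trivial_module
begin

text \<open>Arbitrary lifts of \<open>x\<close> and \<open>y\<close> are rescaled by \<open>r\<close>-th roots, which does not affect their
  commutator; a \<open>t\<close>-th root then absorbs the discrepancy between \<open>[x, y]\<close> and \<open>z\<^sup>t\<close>.\<close>

lemma Hhat_tuple_lift:
  assumes \<alpha>: "\<alpha> \<in> carrier (two_cocycles G M)"
    and divisible: "\<And>u (n::nat). u \<in> carrier M \<Longrightarrow> n > 0 \<Longrightarrow> \<exists>v\<in>carrier M. v [^]\<^bsub>M\<^esub> n = u"
    and r: "odd r \<or> r = 0" and t: "t > 0"
    and tuple: "Hhat_tuple G r t \<psi>" and Z12: "\<psi> GZ1 = \<one>" "\<psi> GZ2 = \<one>"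
  shows "\<exists>\<phi>. Hhat_tuple (extension_group \<alpha>) r t \<phi> \<and> (\<forall>s. fst (\<phi> s) = \<psi> s)"
proof -
  define E where "E = extension_group \<alpha>"
  interpret E: group E unfolding E_def by (rule group_extension_group[OF \<alpha>])
  interpret pr: group_hom E G fst
    unfolding E_def by (intro group_hom.intro group_hom_axioms.intro group_extension_group
        fst_extension_group_hom \<alpha> G.is_group)
  have \<psi>: "\<psi> s \<in> carrier G" for s using tuple by (auto simp: Hhat_tuple_def)
  have central: "a \<otimes>\<^bsub>E\<^esub> b = b \<otimes>\<^bsub>E\<^esub> a" if "a \<in> carrier E" "fst a = \<one>" "b \<in> carrier E" for a b
    using extension_group_kernel_central[OF \<alpha>] that unfolding E_def by blast
  have root: "\<exists>b\<in>carrier E. fst b = \<one> \<and> b [^]\<^bsub>E\<^esub> n = a"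
    if a: "a \<in> carrier E" "fst a = \<one>" and n: "n > 0" for a and n :: nat
  proof -
    \<comment> \<open>The correction by \<open>\<alpha> (\<one>, \<one>)\<close> makes
      \<open>\<zeta>\<close> a homomorphism of \<open>M\<close> onto the kernel of
      \<open>fst\<close>, so roots in \<open>M\<close> give roots in that kernel.\<close>
    define \<zeta> where "\<zeta> = (\<lambda>u. (\<one>, u \<otimes>\<^bsub>M\<^esub> inv\<^bsub>M\<^esub> \<alpha> (\<one>, \<one>)))"
    have [simp]: "\<alpha> (\<one>, \<one>) \<in> carrier M" using \<alpha> by simp
    have "\<zeta> \<in> hom M E"
      by (rule homI) (auto simp: \<zeta>_def E_def M.m_assoc, auto simp: M.m_ac)
    then interpret \<zeta>: group_hom M E \<zeta> by unfold_locales
    define u where "u = snd a \<otimes>\<^bsub>M\<^esub> \<alpha> (\<one>, \<one>)"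
    have u: "u \<in> carrier M" "\<zeta> u = a"
      using a by (auto simp: u_def \<zeta>_def E_def M.m_assoc)
    obtain v where v: "v \<in> carrier M" "v [^]\<^bsub>M\<^esub> n = u" using divisible[OF u(1) n] by blast
    then have "\<zeta> v [^]\<^bsub>E\<^esub> n = a" using u \<zeta>.hom_nat_pow by metis
    moreover have "fst (\<zeta> v) = \<one>" by (simp add: \<zeta>_def)
    ultimately show ?thesis using v(1) \<zeta>.hom_closed by blast
  qed
  have lift: "\<exists>b\<in>carrier E. fst b = g" if "g \<in> carrier G" for g
    using that by (intro bexI[of _ "(g, \<one>\<^bsub>M\<^esub>)"]) (auto simp: E_def)
  \<comment> \<open>A lift \<open>a\<close> can be corrected to have any \<open>n\<close>-th power
    \<open>b\<close> compatible with its image: the discrepancy lies in the central kernel of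
    \<open>fst\<close>, and so does a root of it. For \<open>x\<close> and \<open>y\<close> the
    prescribed power is the unit, for \<open>z\<close> it is the commutator
    \<open>w\<close>.\<close>
  have scale: "\<exists>c\<in>carrier E. fst c = fst a \<and> c [^]\<^bsub>E\<^esub> n = b"
    if a: "a \<in> carrier E" and b: "b \<in> carrier E" and ab: "fst a [^] n = fst b" and n: "n > 0"
    for a b and n :: nat
  proof -
    have "fst (b \<otimes>\<^bsub>E\<^esub> inv\<^bsub>E\<^esub> (a [^]\<^bsub>E\<^esub> n)) = \<one>"
      using a b by (simp add: pr.hom_nat_pow ab)
    then obtain d where d: "d \<in> carrier E" "fst d = \<one>" "d [^]\<^bsub>E\<^esub> n = b \<otimes>\<^bsub>E\<^esub> inv\<^bsub>E\<^esub> (a [^]\<^bsub>E\<^esub> n)"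
      using root[of "b \<otimes>\<^bsub>E\<^esub> inv\<^bsub>E\<^esub> (a [^]\<^bsub>E\<^esub> n)" n] a b n by auto
    have "(d \<otimes>\<^bsub>E\<^esub> a) [^]\<^bsub>E\<^esub> n = d [^]\<^bsub>E\<^esub> n \<otimes>\<^bsub>E\<^esub> a [^]\<^bsub>E\<^esub> n"
      using a d by (intro E.pow_mult_distrib central)
    also have "\<dots> = b" using a b d(3) by (simp add: E.m_assoc)
    finally show ?thesis using a d by (intro bexI[of _ "d \<otimes>\<^bsub>E\<^esub> a"]) auto
  qed
  have torsion_lift: "\<exists>c\<in>carrier E. fst c = g \<and> c [^]\<^bsub>E\<^esub> r = \<one>\<^bsub>E\<^esub>"
    if g: "g \<in> carrier G" "g [^] r = \<one>" for g
  \<comment> \<open>For \<open>r = 0\<close> every lift qualifies, since zeroth powers are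
    trivial.\<close>
  proof (cases "r = 0")
    case False
    obtain a where "a \<in> carrier E" "fst a = g" using lift[OF g(1)] by blast
    then show ?thesis using scale[of a "\<one>\<^bsub>E\<^esub>" r] g False by auto
  qed (use lift[OF g(1)] in auto)
  obtain x where x [simp]: "x \<in> carrier E" "fst x = \<psi> GX" "x [^]\<^bsub>E\<^esub> r = \<one>\<^bsub>E\<^esub>"
    using torsion_lift[of "\<psi> GX"] tuple \<psi> by (auto simp: Hhat_tuple_def)
  obtain y where y [simp]: "y \<in> carrier E" "fst y = \<psi> GY" "y [^]\<^bsub>E\<^esub> r = \<one>\<^bsub>E\<^esub>"
    using torsion_lift[of "\<psi> GY"] tuple \<psi> by (auto simp: Hhat_tuple_def)
  have fst_comm: "fst (a \<otimes>\<^bsub>E\<^esub> b \<otimes>\<^bsub>E\<^esub> inv\<^bsub>E\<^esub> a \<otimes>\<^bsub>E\<^esub> inv\<^bsub>E\<^esub> b) = c"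
    if "a \<in> carrier E" "b \<in> carrier E" "c \<in> carrier G" "fst a \<otimes> fst b = c \<otimes> fst b \<otimes> fst a" for a b c
    using that G.commutator_eq_iff[of "fst a" "fst b" c] by simp
  \<comment> \<open>\<open>w\<close> lies over \<open>\<psi> GZ [^] t\<close>, so
    \<open>scale\<close> yields a lift \<open>z\<close> whose \<open>t\<close>-th power is exactly
    this commutator.\<close>
  define w where "w = x \<otimes>\<^bsub>E\<^esub> y \<otimes>\<^bsub>E\<^esub> inv\<^bsub>E\<^esub> x \<otimes>\<^bsub>E\<^esub> inv\<^bsub>E\<^esub> y"
  have w: "w \<in> carrier E" "fst w = \<psi> GZ [^] t"
    using tuple \<psi> fst_comm[of x y "\<psi> GZ [^] t"] by (simp_all add: w_def Hhat_tuple_def del: pr.hom_mult)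
  obtain z where z [simp]: "z \<in> carrier E" "fst z = \<psi> GZ" "z [^]\<^bsub>E\<^esub> t = w"
    using lift[OF \<psi>[of GZ]] scale[OF _ w(1) _ t] w(2) by metis
  \<comment> \<open>These two values are forced by the relations. They lie over
    \<open>\<psi> GZ1\<close> and \<open>\<psi> GZ2\<close>, which are \<open>\<one>\<close>, and so
    they are central.\<close>
  define z1 where "z1 = x \<otimes>\<^bsub>E\<^esub> z \<otimes>\<^bsub>E\<^esub> inv\<^bsub>E\<^esub> x \<otimes>\<^bsub>E\<^esub> inv\<^bsub>E\<^esub> z"
  define z2 where "z2 = y \<otimes>\<^bsub>E\<^esub> z \<otimes>\<^bsub>E\<^esub> inv\<^bsub>E\<^esub> y \<otimes>\<^bsub>E\<^esub> inv\<^bsub>E\<^esub> z"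
  have z1: "z1 \<in> carrier E" "fst z1 = \<one>"
    using tuple \<psi> fst_comm[of x z "\<one>"] by (simp_all add: z1_def Hhat_tuple_def Z12 del: pr.hom_mult)
  have z2: "z2 \<in> carrier E" "fst z2 = \<one>"
    using tuple \<psi> fst_comm[of y z "\<one>"] by (simp_all add: z2_def Hhat_tuple_def Z12 del: pr.hom_mult)
  have xy: "x \<otimes>\<^bsub>E\<^esub> y = z [^]\<^bsub>E\<^esub> t \<otimes>\<^bsub>E\<^esub> y \<otimes>\<^bsub>E\<^esub> x"
    using E.commutator_eq_iff[of x y w] w(1) by (simp add: w_def)
  have xz: "x \<otimes>\<^bsub>E\<^esub> z = z1 \<otimes>\<^bsub>E\<^esub> z \<otimes>\<^bsub>E\<^esub> x"
    using E.commutator_eq_iff[of x z z1] z1(1) by (simp add: z1_def)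
  have yz: "y \<otimes>\<^bsub>E\<^esub> z = z2 \<otimes>\<^bsub>E\<^esub> z \<otimes>\<^bsub>E\<^esub> y"
    using E.commutator_eq_iff[of y z z2] z2(1) by (simp add: z2_def)
  \<comment> \<open>This relation was not arranged by a choice of lifts. It follows from the others,
    and here the condition that \<open>r\<close> is odd or zero enters.\<close>
  have zrt: "z [^]\<^bsub>E\<^esub> (r * t) = \<one>\<^bsub>E\<^esub>"
    by (rule E.pow_commutator_eq_one[OF x(1) y(1) z(1) z1(1) xy xz _ _ x(3) r])
      (rule central[OF z1, symmetric], simp)+
  define \<phi> where "\<phi> = case_hgen x y z z1 z2"
  have \<phi>: "\<phi> GX = x" "\<phi> GY = y" "\<phi> GZ = z" "\<phi> GZ1 = z1" "\<phi> GZ2 = z2"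
    by (simp_all add: \<phi>_def)
  have closed: "\<forall>s. \<phi> s \<in> carrier E" by (simp add: all_hgen_iff \<phi> z1 z2)
  have "Hhat_tuple E r t \<phi>"
    unfolding Hhat_tuple_def \<phi>
    using closed xy xz yz zrt central[OF z1] central[OF z2] by (auto simp del: z(3))
  moreover have "\<forall>s. fst (\<phi> s) = \<psi> s" by (simp add: all_hgen_iff \<phi> z1 z2 Z12)
  ultimately show ?thesis unfolding E_def by blast
qed

end


section \<open>The Heisenberg group\<close>

lemma heisenberg_group_simps [simp]:
  "carrier (heisenberg_group t R) = carrier R \<times> carrier R \<times> carrier R"
  "(a, b, c) \<otimes>\<^bsub>heisenberg_group t R\<^esub> (a', b', c') =
     (a \<oplus>\<^bsub>R\<^esub> a' \<oplus>\<^bsub>R\<^esub> [t] \<cdot>\<^bsub>R\<^esub> (b' \<otimes>\<^bsub>R\<^esub> c), b \<oplus>\<^bsub>R\<^esub> b', c \<oplus>\<^bsub>R\<^esub> c')"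
  "\<one>\<^bsub>heisenberg_group t R\<^esub> = (\<zero>\<^bsub>R\<^esub>, \<zero>\<^bsub>R\<^esub>, \<zero>\<^bsub>R\<^esub>)"
  by (simp_all add: heisenberg_group_def)

context cring
begin

lemma group_heisenberg_group: "group (heisenberg_group t R)"
proof (rule groupI)
  show "g \<otimes>\<^bsub>heisenberg_group t R\<^esub> h \<otimes>\<^bsub>heisenberg_group t R\<^esub> k
      = g \<otimes>\<^bsub>heisenberg_group t R\<^esub> (h \<otimes>\<^bsub>heisenberg_group t R\<^esub> k)"
    if "g \<in> carrier (heisenberg_group t R)" "h \<in> carrier (heisenberg_group t R)"
      "k \<in> carrier (heisenberg_group t R)" for g h k
    using that by (auto simp: r_distr l_distr add.nat_pow_distrib a_ac)
  show "\<exists>h\<in>carrier (heisenberg_group t R).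
      h \<otimes>\<^bsub>heisenberg_group t R\<^esub> g = \<one>\<^bsub>heisenberg_group t R\<^esub>"
    if g: "g \<in> carrier (heisenberg_group t R)" for g
  proof -
    obtain a b c where g: "g = (a, b, c)" "a \<in> carrier R" "b \<in> carrier R" "c \<in> carrier R"
      using g by auto
    \<comment> \<open>\<open>d\<close> is the twist in the product of
      \<open>(_, \<ominus> b, \<ominus> c)\<close> with \<open>(a, b, c)\<close>, so the first
      coordinate of the inverse has to cancel \<open>a \<oplus> d\<close>.\<close>
    define d where "d = [t] \<cdot> (b \<otimes> (\<ominus> c))"
    have d: "d \<in> carrier R" using g by (simp add: d_def)
    have "(\<ominus> (a \<oplus> d)) \<oplus> a \<oplus> d = \<zero>" using g d by (simp add: a_assoc l_neg)
    then show ?thesis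
      using g d by (intro bexI[of _ "(\<ominus> (a \<oplus> d), \<ominus> b, \<ominus> c)"]) (auto simp: l_neg d_def)
  qed
qed auto

text \<open>On each coordinate axis the twist \<open>b' \<otimes> c\<close> vanishes, so the axis is
  a homomorphic copy of the additive group of \<open>R\<close>.\<close>

lemma heisenberg_pow:
  assumes [simp]: "a \<in> carrier R"
  shows "(a, \<zero>, \<zero>) [^]\<^bsub>heisenberg_group t R\<^esub> (k::int) = ([k] \<cdot> a, \<zero>, \<zero>)"
    and "(\<zero>, a, \<zero>) [^]\<^bsub>heisenberg_group t R\<^esub> k = (\<zero>, [k] \<cdot> a, \<zero>)"
    and "(\<zero>, \<zero>, a) [^]\<^bsub>heisenberg_group t R\<^esub> k = (\<zero>, \<zero>, [k] \<cdot> a)"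
proof -
  have "(\<lambda>a. (a, \<zero>, \<zero>)) \<in> hom (add_monoid R) (heisenberg_group t R)"
    "(\<lambda>a. (\<zero>, a, \<zero>)) \<in> hom (add_monoid R) (heisenberg_group t R)"
    "(\<lambda>a. (\<zero>, \<zero>, a)) \<in> hom (add_monoid R) (heisenberg_group t R)"
    by (auto intro!: homI)
  note * = this[THEN hom_int_pow, of a k, OF _ a_group group_heisenberg_group]
  show "(a, \<zero>, \<zero>) [^]\<^bsub>heisenberg_group t R\<^esub> k = ([k] \<cdot> a, \<zero>, \<zero>)"
    "(\<zero>, a, \<zero>) [^]\<^bsub>heisenberg_group t R\<^esub> k = (\<zero>, [k] \<cdot> a, \<zero>)"
    "(\<zero>, \<zero>, a) [^]\<^bsub>heisenberg_group t R\<^esub> k = (\<zero>, \<zero>, [k] \<cdot> a)"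
    using * by (simp_all add: add_pow_def)
qed

text \<open>The twist is \<open>b' \<otimes> c\<close>, so \<open>GX\<close> goes to the third
  coordinate: the image of \<open>xy\<close> then has first coordinate
  \<open>[t] \<cdot> \<one>\<close>, that of \<open>yx\<close> has \<open>\<zero>\<close>.\<close>

definition heisenberg_gen :: "hgen \<Rightarrow> 'a \<times> 'a \<times> 'a" where
  "heisenberg_gen =
     case_hgen (\<zero>, \<zero>, \<one>) (\<zero>, \<one>, \<zero>) (\<one>, \<zero>, \<zero>) (\<zero>, \<zero>, \<zero>) (\<zero>, \<zero>, \<zero>)"

lemma heisenberg_gen_simps [simp]:
  "heisenberg_gen GX = (\<zero>, \<zero>, \<one>)" "heisenberg_gen GY = (\<zero>, \<one>, \<zero>)"
  "heisenberg_gen GZ = (\<one>, \<zero>, \<zero>)" "heisenberg_gen GZ1 = (\<zero>, \<zero>, \<zero>)"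
  "heisenberg_gen GZ2 = (\<zero>, \<zero>, \<zero>)"
  by (simp_all add: heisenberg_gen_def)

lemma Hhat_tuple_heisenberg_gen:
  assumes "[r] \<cdot> \<one> = \<zero>"
  shows "Hhat_tuple (heisenberg_group t R) r t heisenberg_gen"
proof -
  have pow: "(a, \<zero>, \<zero>) [^]\<^bsub>heisenberg_group t R\<^esub> n = ([n] \<cdot> a, \<zero>, \<zero>)"
    "(\<zero>, a, \<zero>) [^]\<^bsub>heisenberg_group t R\<^esub> n = (\<zero>, [n] \<cdot> a, \<zero>)"
    "(\<zero>, \<zero>, a) [^]\<^bsub>heisenberg_group t R\<^esub> n = (\<zero>, \<zero>, [n] \<cdot> a)"
    if "a \<in> carrier R" for a and n :: nat
    using heisenberg_pow[OF that, of t "int n"] by (simp_all add: int_pow_int add_pow_def)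
  have "[(r * t)] \<cdot> \<one> = \<zero>"
    using add.nat_pow_pow[of \<one> t r] assms by simp
  moreover have "\<forall>s. heisenberg_gen s \<in> carrier (heisenberg_group t R)"
    by (simp add: all_hgen_iff)
  then have "range heisenberg_gen \<subseteq> carrier (heisenberg_group t R)" by blast
  ultimately show ?thesis
    using assms unfolding Hhat_tuple_def by (simp add: pow all_hgen_iff)
qed

text \<open>With \<open>y\<close> first, then \<open>x\<close>, then \<open>z\<close>, every twist
  has \<open>b' = \<zero>\<close>, so the exponents appear as coordinates. This explains the order
  chosen for the normal form.\<close>

lemma heisenberg_normal_form:
  fixes i j k :: int
  shows "heisenberg_gen GY [^]\<^bsub>heisenberg_group t R\<^esub> j \<otimes>\<^bsub>heisenberg_group t R\<^esub>
   heisenberg_gen GX [^]\<^bsub>heisenberg_group t R\<^esub> i \<otimes>\<^bsub>heisenberg_group t R\<^esub>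
   heisenberg_gen GZ [^]\<^bsub>heisenberg_group t R\<^esub> k = ([k] \<cdot> \<one>, [j] \<cdot> \<one>, [i] \<cdot> \<one>)"
  by (simp add: heisenberg_pow add.int_pow_closed)

end

section \<open>Residue rings of the integers, and the nonzero complex numbers\<close>

lemma ZFact_add_pow_one:
  fixes k :: int
  shows "add_pow (ZFact n) k \<one>\<^bsub>ZFact n\<^esub> = ZMod n k"
proof -
  interpret I: ideal "Idl\<^bsub>\<Z>\<^esub> {n}" \<Z> by (rule int.genideal_ideal) fast
  interpret Q: cring "ZFact n" by (rule ZFact_is_cring)
  have hom: "ZMod n \<in> hom (add_monoid \<Z>) (add_monoid (ZFact n))"
    using I.rcos_ring_hom unfolding ZMod_def[abs_def] ZFact_def
    by (auto simp: ring_hom_def hom_def)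
  have "add_pow \<Z> m (1::int) = int m" for m :: nat
    by (induction m) (auto simp: add_pow_def)
  then have "add_pow \<Z> k (1::int) = k"
    using add_pow_int_ge[of k \<Z> 1] add_pow_int_lt[of k \<Z> 1]
    by (cases "k \<ge> 0") (auto simp: int_a_inv_eq)
  moreover have "\<one>\<^bsub>ZFact n\<^esub> = ZMod n 1" by (simp add: ZFact_def ZMod_def FactRing_def)
  ultimately show ?thesis
    using hom_int_pow[OF hom, of 1 k] int.add.is_group Q.add.is_group
    by (simp add: add_pow_def)
qed

lemma carrier_ZFact: "carrier (ZFact n) = range (ZMod n)"
  by (auto simp: ZFact_def FactRing_def A_RCOSETS_def' ZMod_def)

text \<open>Covers \<open>n = 0\<close> as well, where \<open>k mod 0\<close> is \<open>k\<close>
  and \<open>0\<close> divides only \<open>0\<close>.\<close>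

lemma ZMod_eq_zero_iff: "ZMod n k = \<zero>\<^bsub>ZFact n\<^esub> \<longleftrightarrow> n dvd k"
proof -
  interpret Q: cring "ZFact n" by (rule ZFact_is_cring)
  have "ZMod n 0 = \<zero>\<^bsub>ZFact n\<^esub>"
    using ZFact_add_pow_one[of n 0] by (simp add: add_pow_def)
  then have "ZMod n k = \<zero>\<^bsub>ZFact n\<^esub> \<longleftrightarrow> k mod n = 0"
    using ZMod_eq_mod[of n k 0] by simp
  then show ?thesis by (simp add: dvd_eq_mod_eq_0)
qed

lemma Hhat_tuple_H3: "Hhat_tuple (H3 t r) r t (cring.heisenberg_gen (ZFact (int r)))"
proof -
  interpret Z: cring "ZFact (int r)" by (rule ZFact_is_cring)
  show ?thesis
    using ZFact_add_pow_one[of "int r" "int r"] ZMod_eq_zero_iff[of "int r" "int r"]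
    unfolding H3_def by (intro Z.Hhat_tuple_heisenberg_gen) (simp add: add_pow_def int_pow_int)
qed

lemma comm_group_complex_units: "comm_group complex_units"
  by (rule comm_groupI) (auto simp: complex_units_def intro!: exI[of _ "inverse _"] bexI[of _ "inverse _"])

text \<open>The root is taken in polar form. Divisibility is what allows lifted generators to be
  corrected in \<open>Hhat_tuple_lift\<close>.\<close>

lemma complex_units_divisible:
  assumes "u \<in> carrier complex_units" "n > 0"
  shows "\<exists>v\<in>carrier complex_units. v [^]\<^bsub>complex_units\<^esub> (n::nat) = u"
proof -
  have pow: "v [^]\<^bsub>complex_units\<^esub> n = v ^ n" for v and n :: nat
    by (induction n) (simp_all add: complex_units_def)
  define v where "v = rcis (root n (cmod u)) (Arg u / n)"
  have "v ^ n = u" using assms(2) by (simp add: v_def DeMoivre2 rcis_cmod_Arg)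
  moreover from this have "v \<noteq> 0" using assms by (auto simp: complex_units_def)
  ultimately show ?thesis
    by (intro bexI[of _ v]) (simp_all only: pow, simp add: complex_units_def)
qed


section \<open>The projection to the Heisenberg group\<close>

lemma (in comm_group) commutator_trivial:
  assumes "a \<in> carrier G" "b \<in> carrier G" "c \<in> carrier G" "a \<otimes> b = c \<otimes> b \<otimes> a"
  shows "c = \<one>"
  using assms commutator_eq_iff[of a b c] by (simp add: m_ac inv_mult_cancel)

locale Hhat_group =
  fixes r t :: nat and H
  assumes H: "H = Hhat r t"
begin

abbreviation gx where "gx \<equiv> hgen_class r t GX"
abbreviation gy where "gy \<equiv> hgen_class r t GY"
abbreviation gz where "gz \<equiv> hgen_class r t GZ"
abbreviation gz1 where "gz1 \<equiv> hgen_class r t GZ1"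
abbreviation gz2 where "gz2 \<equiv> hgen_class r t GZ2"

sublocale H: group H unfolding H by (rule group_Hhat)

lemma tuple: "Hhat_tuple H r t (hgen_class r t)"
  unfolding H by (rule Hhat_tuple_Hhat)

lemma closed [simp]: "hgen_class r t s \<in> carrier H"
  using tuple by (auto simp: Hhat_tuple_def)

lemma relations:
  "gx \<otimes>\<^bsub>H\<^esub> gy = gz [^]\<^bsub>H\<^esub> t \<otimes>\<^bsub>H\<^esub> gy \<otimes>\<^bsub>H\<^esub> gx"
  "gx \<otimes>\<^bsub>H\<^esub> gz = gz1 \<otimes>\<^bsub>H\<^esub> gz \<otimes>\<^bsub>H\<^esub> gx"
  "gy \<otimes>\<^bsub>H\<^esub> gz = gz2 \<otimes>\<^bsub>H\<^esub> gz \<otimes>\<^bsub>H\<^esub> gy"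
  "gx [^]\<^bsub>H\<^esub> r = \<one>\<^bsub>H\<^esub>" "gy [^]\<^bsub>H\<^esub> r = \<one>\<^bsub>H\<^esub>"
  "gz1 \<otimes>\<^bsub>H\<^esub> hgen_class r t s = hgen_class r t s \<otimes>\<^bsub>H\<^esub> gz1"
  "gz2 \<otimes>\<^bsub>H\<^esub> hgen_class r t s = hgen_class r t s \<otimes>\<^bsub>H\<^esub> gz2"
  using tuple by (auto simp: Hhat_tuple_def)

lemma subgroup_eqI:
  assumes "subgroup S H" "\<And>s. hgen_class r t s \<in> S"
  shows "S = carrier H"
  using subgroup_presented_group_eqI[of S "Hhat_relations r t"] assms by (simp add: H Hhat_def)

lemma central_if_commutes:
  assumes a: "a \<in> carrier H" and "\<And>s. a \<otimes>\<^bsub>H\<^esub> hgen_class r t s = hgen_class r t s \<otimes>\<^bsub>H\<^esub> a"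
    and e: "e \<in> carrier H"
  shows "a \<otimes>\<^bsub>H\<^esub> e = e \<otimes>\<^bsub>H\<^esub> a"
proof -
  have "{g \<in> carrier H. a \<otimes>\<^bsub>H\<^esub> g = g \<otimes>\<^bsub>H\<^esub> a} = carrier H"
    using assms by (intro subgroup_eqI H.subgroup_centralizer) auto
  then show ?thesis using e by blast
qed

text \<open>Modulo this central subgroup \<open>gz\<close> commutes with \<open>gx\<close> and
  \<open>gy\<close>, as the collection process requires.\<close>

definition C where "C = generate H {gz1, gz2}"

lemma subgroup_C: "subgroup C H"
  unfolding C_def by (rule H.generate_is_subgroup) auto

lemma C_subset: "w \<in> C \<Longrightarrow> w \<in> carrier H"
  using subgroup.subset[OF subgroup_C] by blast

lemma C_central: "w \<in> C \<Longrightarrow> e \<in> carrier H \<Longrightarrow> w \<otimes>\<^bsub>H\<^esub> e = e \<otimes>\<^bsub>H\<^esub> w"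
  using central_if_commutes[OF closed relations(6)] central_if_commutes[OF closed relations(7)]
  unfolding C_def by (intro H.commutes_generate[symmetric, of e "{gz1, gz2}"]) (simp, simp, force, simp)

lemma C_killed:
  assumes "group_hom H K h" "h gz1 = \<one>\<^bsub>K\<^esub>" "h gz2 = \<one>\<^bsub>K\<^esub>" "w \<in> C"
  shows "h w = \<one>\<^bsub>K\<^esub>"
proof -
  interpret h: group_hom H K h by fact
  have "C \<subseteq> kernel H K h"
    unfolding C_def using assms by (intro H.generate_subgroup_incl h.subgroup_kernel) (auto simp: kernel_def)
  then show ?thesis using assms(4) by (auto simp: kernel_def)
qed

text \<open>In the quotient by \<open>C\<close> the images of \<open>gz1\<close> and
  \<open>gz2\<close> vanish, so the sorted expressions form a subgroup there. It contains the image
  of every generator, hence of every element.\<close>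

lemma normal_form:
  assumes e: "e \<in> carrier H"
  obtains w i j k where "w \<in> C"
    "e = w \<otimes>\<^bsub>H\<^esub> (gy [^]\<^bsub>H\<^esub> (j::int) \<otimes>\<^bsub>H\<^esub> gx [^]\<^bsub>H\<^esub> (i::int) \<otimes>\<^bsub>H\<^esub> gz [^]\<^bsub>H\<^esub> (k::int))"
proof -
  interpret C: subgroup C H by (rule subgroup_C)
  interpret N: normal C H
  proof (rule H.normal_invI[OF subgroup_C])
    fix g w assume g: "g \<in> carrier H" and w: "w \<in> C"
    have "g \<otimes>\<^bsub>H\<^esub> w \<otimes>\<^bsub>H\<^esub> inv\<^bsub>H\<^esub> g = w"
      using g w C_subset[OF w] by (simp add: H.m_assoc flip: C_central[OF w g])
    then show "g \<otimes>\<^bsub>H\<^esub> w \<otimes>\<^bsub>H\<^esub> inv\<^bsub>H\<^esub> g \<in> C" using w by simp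
  qed
  define Q where "Q = H Mod C"
  interpret Q: group Q unfolding Q_def by (rule N.factorgroup_is_group)
  define q where "q = (\<lambda>a. C #>\<^bsub>H\<^esub> a)"
  interpret q: group_hom H Q q
    unfolding q_def Q_def by (intro group_hom.intro group_hom_axioms.intro N.r_coset_hom_Mod
        N.factorgroup_is_group H.is_group)
  have "gz1 \<in> C" "gz2 \<in> C" unfolding C_def by (auto intro: generate.incl)
  then have [simp]: "q gz1 = \<one>\<^bsub>Q\<^esub>" "q gz2 = \<one>\<^bsub>Q\<^esub>"
    by (simp_all add: q_def Q_def FactGroup_def C.rcos_const H.is_group)
  define S where "S = {q gy [^]\<^bsub>Q\<^esub> j \<otimes>\<^bsub>Q\<^esub> q gx [^]\<^bsub>Q\<^esub> i \<otimes>\<^bsub>Q\<^esub> q gz [^]\<^bsub>Q\<^esub> k | (i::int) (j::int) (k::int). True}"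
  have S: "subgroup S Q"
    unfolding S_def
  proof (rule Q.heisenberg_normal_form_subgroup)
    show "q gx \<otimes>\<^bsub>Q\<^esub> q gy = q gz [^]\<^bsub>Q\<^esub> t \<otimes>\<^bsub>Q\<^esub> q gy \<otimes>\<^bsub>Q\<^esub> q gx"
      using arg_cong[OF relations(1), of q] by (simp add: q.hom_nat_pow)
    show "q gx \<otimes>\<^bsub>Q\<^esub> q gz = q gz \<otimes>\<^bsub>Q\<^esub> q gx" using arg_cong[OF relations(2), of q] by simp
    show "q gy \<otimes>\<^bsub>Q\<^esub> q gz = q gz \<otimes>\<^bsub>Q\<^esub> q gy" using arg_cong[OF relations(3), of q] by simp
  qed simp_all
  have in_S: "q gy [^]\<^bsub>Q\<^esub> j \<otimes>\<^bsub>Q\<^esub> q gx [^]\<^bsub>Q\<^esub> i \<otimes>\<^bsub>Q\<^esub> q gz [^]\<^bsub>Q\<^esub> k \<in> S" for i j k :: int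
    unfolding S_def by blast
  have "{g \<in> carrier H. q g \<in> S} = carrier H"
  proof (rule subgroup_eqI[OF q.subgroup_preimage[OF S]])
    have "q (hgen_class r t s) \<in> S" for s
      using in_S[of 0 1 0] in_S[of 1 0 0] in_S[of 0 0 1] in_S[of 0 0 0] by (cases s) simp_all
    then show "hgen_class r t s \<in> {g \<in> carrier H. q g \<in> S}" for s by simp
  qed
  then have "q e \<in> S" using e by blast
  then obtain i j k :: int where
    "q e = q gy [^]\<^bsub>Q\<^esub> j \<otimes>\<^bsub>Q\<^esub> q gx [^]\<^bsub>Q\<^esub> i \<otimes>\<^bsub>Q\<^esub> q gz [^]\<^bsub>Q\<^esub> k"
    unfolding S_def by blast
  then have "q e = q (gy [^]\<^bsub>H\<^esub> j \<otimes>\<^bsub>H\<^esub> gx [^]\<^bsub>H\<^esub> i \<otimes>\<^bsub>H\<^esub> gz [^]\<^bsub>H\<^esub> k)"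
    by (simp add: q.hom_int_pow)
  then have "e \<in> C #>\<^bsub>H\<^esub> (gy [^]\<^bsub>H\<^esub> j \<otimes>\<^bsub>H\<^esub> gx [^]\<^bsub>H\<^esub> i \<otimes>\<^bsub>H\<^esub> gz [^]\<^bsub>H\<^esub> k)"
    using H.rcos_self[OF e subgroup_C] by (simp add: q_def)
  then show thesis using that by (auto simp: r_coset_def)
qed

text \<open>For the kernel, compare coordinates: a normal form that maps to the unit has all three
  exponents divisible by \<open>r\<close>, and the powers of \<open>gx\<close> and \<open>gy\<close>
  then vanish because their \<open>r\<close>-th powers are trivial.\<close>

lemma H3_projection:
  obtains p where "p \<in> epi H (H3 t r)"
    and "\<And>s. p (hgen_class r t s) = cring.heisenberg_gen (ZFact (int r)) s"
    and "\<And>a. a \<in> kernel H (H3 t r) p \<Longrightarrow> \<exists>w\<in>C. \<exists>k::int. a = w \<otimes>\<^bsub>H\<^esub> (gz [^]\<^bsub>H\<^esub> r) [^]\<^bsub>H\<^esub> k"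
proof -
  define Z where "Z = ZFact (int r)"
  define \<iota> where "\<iota> = ZMod (int r)"
  interpret Z: cring Z unfolding Z_def by (rule ZFact_is_cring)
  have G: "H3 t r = heisenberg_group t Z" by (simp add: H3_def Z_def)
  interpret G: group "H3 t r" unfolding G by (rule Z.group_heisenberg_group)
  have \<iota>_eq: "add_pow Z (k::int) \<one>\<^bsub>Z\<^esub> = \<iota> k" for k
    unfolding Z_def \<iota>_def by (rule ZFact_add_pow_one)
  have \<iota>_zero: "\<iota> k = \<zero>\<^bsub>Z\<^esub> \<longleftrightarrow> int r dvd k" for k
    unfolding Z_def \<iota>_def by (rule ZMod_eq_zero_iff)
  have tuple_G: "Hhat_tuple (H3 t r) r t Z.heisenberg_gen"
    unfolding Z_def by (rule Hhat_tuple_H3)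
  then have gen_closed: "Z.heisenberg_gen s \<in> carrier (H3 t r)" for s
    by (auto simp: Hhat_tuple_def)
  obtain p where p: "p \<in> hom H (H3 t r)"
    and p_eq: "\<And>w. p (word_class (Hhat_relations r t) w) = eval_word (H3 t r) Z.heisenberg_gen w"
    using G.Hhat_hom[OF tuple_G] unfolding H by metis
  interpret p: group_hom H "H3 t r" p by unfold_locales (rule p)
  have p_gen: "p (hgen_class r t s) = Z.heisenberg_gen s" for s
    by (simp add: p_eq G.eval_gen_word gen_closed)
  \<comment> \<open>Exponents become residues in the three coordinates. This gives surjectivity of
    \<open>p\<close> and, by comparison with the unit, the description of its kernel.\<close>
  have p_nf: "p (gy [^]\<^bsub>H\<^esub> j \<otimes>\<^bsub>H\<^esub> gx [^]\<^bsub>H\<^esub> i \<otimes>\<^bsub>H\<^esub> gz [^]\<^bsub>H\<^esub> k) = (\<iota> k, \<iota> j, \<iota> i)" for i j k :: int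
    using Z.heisenberg_normal_form[where t = t and i = i and j = j and k = k]
    by (simp add: p.hom_int_pow p_gen \<iota>_eq G del: Z.heisenberg_gen_simps)
  show thesis
  proof (rule that)
    have "g \<in> p ` carrier H" if g: "g \<in> carrier (H3 t r)" for g
    proof -
      obtain i j k where "g = (\<iota> k, \<iota> j, \<iota> i)"
        using g carrier_ZFact[of "int r"] by (auto simp: G Z_def \<iota>_def)
      then show ?thesis unfolding p_nf[symmetric] by (rule image_eqI) simp
    qed
    then show "p \<in> epi H (H3 t r)" using p p.hom_closed by (auto simp: epi_def)
    show "p (hgen_class r t s) = cring.heisenberg_gen (ZFact (int r)) s" for s
      unfolding Z_def[symmetric] by (rule p_gen)
    fix a assume a: "a \<in> kernel H (H3 t r) p"
    then have "a \<in> carrier H" by (simp add: kernel_def)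
    then obtain w i j k where w: "w \<in> C"
      and a_eq: "a = w \<otimes>\<^bsub>H\<^esub> (gy [^]\<^bsub>H\<^esub> (j::int) \<otimes>\<^bsub>H\<^esub> gx [^]\<^bsub>H\<^esub> (i::int) \<otimes>\<^bsub>H\<^esub> gz [^]\<^bsub>H\<^esub> (k::int))"
      by (rule normal_form)
    have "p w = \<one>\<^bsub>H3 t r\<^esub>"
      by (rule C_killed[OF p.group_hom_axioms _ _ w]) (simp_all add: p_gen G)
    then have "p a = p (gy [^]\<^bsub>H\<^esub> j \<otimes>\<^bsub>H\<^esub> gx [^]\<^bsub>H\<^esub> i \<otimes>\<^bsub>H\<^esub> gz [^]\<^bsub>H\<^esub> k)"
      using C_subset[OF w] by (simp add: a_eq)
    then have "p a = (\<iota> k, \<iota> j, \<iota> i)" by (simp only: p_nf)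
    then have "int r dvd i" "int r dvd j" "int r dvd k"
      using a by (auto simp: kernel_def G \<iota>_zero[symmetric])
    then obtain i' j' k' where [simp]: "i = int r * i'" "j = int r * j'" "k = int r * k'"
      by (auto elim!: dvdE)
    have "g [^]\<^bsub>H\<^esub> (int r * l) = (g [^]\<^bsub>H\<^esub> r) [^]\<^bsub>H\<^esub> l" if "g \<in> carrier H" for g l
      using H.int_pow_pow[OF that, of "int r" l] by (simp add: int_pow_int)
    then have "a = w \<otimes>\<^bsub>H\<^esub> (gz [^]\<^bsub>H\<^esub> r) [^]\<^bsub>H\<^esub> k'"
      by (simp add: a_eq relations)
    then show "\<exists>w\<in>C. \<exists>k::int. a = w \<otimes>\<^bsub>H\<^esub> (gz [^]\<^bsub>H\<^esub> r) [^]\<^bsub>H\<^esub> k" using w by blast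
  qed
qed

text \<open>Conjugation by \<open>gx\<close> multiplies \<open>gz [^] r\<close> by the
  \<open>r\<close>-th power of \<open>gz1\<close>, which is trivial because \<open>gx\<close> has
  trivial \<open>r\<close>-th power; likewise for \<open>gy\<close> and \<open>gz2\<close>.\<close>

lemma gz_pow_central:
  assumes e: "e \<in> carrier H"
  shows "(gz [^]\<^bsub>H\<^esub> r) \<otimes>\<^bsub>H\<^esub> e = e \<otimes>\<^bsub>H\<^esub> (gz [^]\<^bsub>H\<^esub> r)"
proof (rule central_if_commutes[OF _ _ e])
  have gen: "g \<otimes>\<^bsub>H\<^esub> gz [^]\<^bsub>H\<^esub> r = gz [^]\<^bsub>H\<^esub> r \<otimes>\<^bsub>H\<^esub> g"
    if g: "g \<in> carrier H" "c \<in> carrier H" "g \<otimes>\<^bsub>H\<^esub> gz = c \<otimes>\<^bsub>H\<^esub> gz \<otimes>\<^bsub>H\<^esub> g"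
      and c: "c \<otimes>\<^bsub>H\<^esub> g = g \<otimes>\<^bsub>H\<^esub> c" "c \<otimes>\<^bsub>H\<^esub> gz = gz \<otimes>\<^bsub>H\<^esub> c" and gr: "g [^]\<^bsub>H\<^esub> r = \<one>\<^bsub>H\<^esub>" for g c
  proof -
    have "c [^]\<^bsub>H\<^esub> r = \<one>\<^bsub>H\<^esub>"
      by (rule H.conj_int_pow_trivial[OF g(1) closed g(2,3) c(1,2)[symmetric] gr])
    then show ?thesis
      using H.mult_int_pow_eq[OF g(1) closed g(2,3) c(2)[symmetric], of "int r"] g
      by (simp add: int_pow_int)
  qed
  show "gz [^]\<^bsub>H\<^esub> r \<otimes>\<^bsub>H\<^esub> hgen_class r t s = hgen_class r t s \<otimes>\<^bsub>H\<^esub> gz [^]\<^bsub>H\<^esub> r" for s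
  proof (cases s)
    case GX
    then show ?thesis using gen[of gx gz1] by (simp add: relations)
  next
    case GY
    then show ?thesis using gen[of gy gz2] by (simp add: relations)
  qed (simp_all add: H.commutes_nat_pow[symmetric] relations)
qed simp

end

section \<open>Characters of the kernel, and lifts to extensions of the Heisenberg group\<close>

theorem theorem1p2:
  fixes r t :: nat
  assumes "odd r \<or> r = 0"
    and "t > 0"
    and "t dvd r"
  shows "representation_group (Hhat r t) (H3 t r)"
proof -
  define H where "H = Hhat r t"
  interpret Hhat_group r t H by unfold_locales (rule H_def)
  interpret Z: cring "ZFact (int r)" by (rule ZFact_is_cring)
  interpret G: group "H3 t r" unfolding H3_def by (rule Z.group_heisenberg_group)
  interpret U: comm_group complex_units by (rule comm_group_complex_units)
  interpret T: trivial_module "H3 t r" complex_units by unfold_locales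
  obtain p where p: "p \<in> epi H (H3 t r)"
    and p_gen: "\<And>s. p (hgen_class r t s) = Z.heisenberg_gen s"
    and ker: "\<And>a. a \<in> kernel H (H3 t r) p \<Longrightarrow> \<exists>w\<in>C. \<exists>k::int. a = w \<otimes>\<^bsub>H\<^esub> (gz [^]\<^bsub>H\<^esub> r) [^]\<^bsub>H\<^esub> k"
    using H3_projection by metis
  interpret p: group_hom H "H3 t r" p by unfold_locales (use p in \<open>simp add: epi_def\<close>)
  \<comment> \<open>The kernel itself with the inclusion map, so that elements of \<open>A\<close>
    have the same type as those of \<open>H\<close>.\<close>
  define A where "A = H\<lparr>carrier := kernel H (H3 t r) p\<rparr>"
  have A: "group A" unfolding A_def by (rule H.subgroup_imp_group[OF p.subgroup_kernel])
  have kernel_central: "a \<otimes>\<^bsub>H\<^esub> e = e \<otimes>\<^bsub>H\<^esub> a"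
    if a: "a \<in> kernel H (H3 t r) p" and e: "e \<in> carrier H" for a e
  proof -
    obtain w and k :: int where w: "w \<in> C" and a_eq: "a = w \<otimes>\<^bsub>H\<^esub> (gz [^]\<^bsub>H\<^esub> r) [^]\<^bsub>H\<^esub> k"
      using ker[OF a] by blast
    have k: "e \<otimes>\<^bsub>H\<^esub> (gz [^]\<^bsub>H\<^esub> r) [^]\<^bsub>H\<^esub> k = (gz [^]\<^bsub>H\<^esub> r) [^]\<^bsub>H\<^esub> k \<otimes>\<^bsub>H\<^esub> e"
      by (intro H.commutes_int_pow gz_pow_central[symmetric] e) simp
    have "a \<otimes>\<^bsub>H\<^esub> e = (w \<otimes>\<^bsub>H\<^esub> e) \<otimes>\<^bsub>H\<^esub> (gz [^]\<^bsub>H\<^esub> r) [^]\<^bsub>H\<^esub> k"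
      using C_subset[OF w] e by (simp add: a_eq H.m_assoc k)
    also have "\<dots> = e \<otimes>\<^bsub>H\<^esub> a"
      using C_subset[OF w] e by (simp add: a_eq H.m_assoc C_central[OF w e])
    finally show ?thesis .
  qed
  have central: "central_extension A (\<lambda>a. a) H p (H3 t r)"
    unfolding central_extension_def using A p kernel_central
    by (auto simp: A_def mon_def hom_def kernel_def)
  \<comment> \<open>Values in a commutative group kill the commutators \<open>gz1\<close>,
    \<open>gz2\<close> and \<open>gz [^] t\<close>; this is the hypothesis of injectivity.\<close>
  have killed: "F a = \<one>\<^bsub>complex_units\<^esub>"
    if F: "F \<in> hom H complex_units" and a: "a \<in> carrier A" for F a
  proof -
    interpret F: group_hom H complex_units F by unfold_locales (rule F)
    have "F gz1 = \<one>\<^bsub>complex_units\<^esub>"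
      using arg_cong[OF relations(2), of F] by (intro U.commutator_trivial[of "F gx" "F gz"]) simp_all
    moreover have "F gz2 = \<one>\<^bsub>complex_units\<^esub>"
      using arg_cong[OF relations(3), of F] by (intro U.commutator_trivial[of "F gy" "F gz"]) simp_all
    ultimately have F_C: "F w = \<one>\<^bsub>complex_units\<^esub>" if "w \<in> C" for w
      using C_killed[OF F.group_hom_axioms] that by blast
    have F_t: "F gz [^]\<^bsub>complex_units\<^esub> t = \<one>\<^bsub>complex_units\<^esub>"
      using arg_cong[OF relations(1), of F]
      by (intro U.commutator_trivial[of "F gx" "F gy"]) (simp_all add: F.hom_nat_pow)
    \<comment> \<open>Here the divisibility of \<open>r\<close> by \<open>t\<close> enters: it
      passes from \<open>gz [^] t\<close> to \<open>gz [^] r\<close>, whose powers together with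
      \<open>C\<close> account for the kernel.\<close>
    obtain s where s: "r = t * s" using assms(3) by blast
    have "F gz [^]\<^bsub>complex_units\<^esub> (t * s) = \<one>\<^bsub>complex_units\<^esub>"
      using U.nat_pow_pow[of "F gz" t s] by (simp add: F_t)
    then have F_r: "F gz [^]\<^bsub>complex_units\<^esub> r = \<one>\<^bsub>complex_units\<^esub>" by (simp only: s[symmetric])
    obtain w and k :: int where w: "w \<in> C" and a_eq: "a = w \<otimes>\<^bsub>H\<^esub> (gz [^]\<^bsub>H\<^esub> r) [^]\<^bsub>H\<^esub> k"
      using ker[of a] a by (auto simp: A_def)
    then show ?thesis
      using C_subset[OF w] by (simp add: F_C F.hom_int_pow F.hom_nat_pow F_r)
  qed
  have lift: "\<exists>\<phi>\<in>hom H (T.extension_group \<alpha>). \<forall>e\<in>carrier H. fst (\<phi> e) = p e"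
    if \<alpha>: "\<alpha> \<in> carrier (two_cocycles (H3 t r) complex_units)" for \<alpha>
  proof -
    interpret E: group "T.extension_group \<alpha>" by (rule T.group_extension_group[OF \<alpha>])
    interpret pr: group_hom "T.extension_group \<alpha>" "H3 t r" fst
      by unfold_locales (rule T.fst_extension_group_hom[OF \<alpha>])
    have "Z.heisenberg_gen GZ1 = \<one>\<^bsub>H3 t r\<^esub>" "Z.heisenberg_gen GZ2 = \<one>\<^bsub>H3 t r\<^esub>"
      by (simp_all add: H3_def)
    then obtain \<phi> where \<phi>: "Hhat_tuple (T.extension_group \<alpha>) r t \<phi>" "\<And>s. fst (\<phi> s) = Z.heisenberg_gen s"
      using T.Hhat_tuple_lift[OF \<alpha> complex_units_divisible assms(1,2) Hhat_tuple_H3] by blast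
    obtain h where h: "h \<in> hom H (T.extension_group \<alpha>)"
      and h_eq: "\<And>w. h (word_class (Hhat_relations r t) w) = eval_word (T.extension_group \<alpha>) \<phi> w"
      using E.Hhat_hom[OF \<phi>(1)] unfolding H_def by metis
    interpret h: group_hom H "T.extension_group \<alpha>" h by unfold_locales (rule h)
    have \<phi>_closed: "\<phi> s \<in> carrier (T.extension_group \<alpha>)" for s
      using \<phi>(1) by (auto simp: Hhat_tuple_def)
    \<comment> \<open>Both sides evaluate a word representing \<open>e\<close> at the same images of
      the generators.\<close>
    have "fst (h e) = p e" if e: "e \<in> carrier H" for e
    proof -
      obtain w where w: "e = word_class (Hhat_relations r t) w"
        using e by (auto simp: H_def Hhat_def carrier_presented_group)
      have "e = eval_word H (hgen_class r t) w"
        unfolding w H_def Hhat_def eval_word_presented_group ..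
      then have "p e = eval_word (H3 t r) Z.heisenberg_gen w"
        by (simp add: p.hom_eval_word p_gen)
      moreover have "fst (h e) = eval_word (H3 t r) Z.heisenberg_gen w"
        unfolding w h_eq by (subst pr.hom_eval_word[OF \<phi>_closed]) (simp add: \<phi>(2))
      ultimately show ?thesis by simp
    qed
    then show ?thesis using h by blast
  qed
  have "transgression A (\<lambda>a. a) H (H3 t r) complex_units \<mu> \<in>
      iso (Hom_group A complex_units) (H2 (H3 t r) complex_units)"
    if "set_section H p (H3 t r) \<mu>" for \<mu>
  proof -
    interpret sectioned_central_extension "H3 t r" complex_units A H "\<lambda>a. a" p \<mu>
      by (intro sectioned_central_extension.intro sectioned_central_extension_axioms.intro
          T.trivial_module_axioms A H.is_group central that)
    show ?thesis by (rule transgression_iso) (fact killed, fact lift)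
  qed
  then show ?thesis unfolding representation_group_def H_def[symmetric] using central by blast
qed

end
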